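(* Let $X$ be a Banach space and let $Y \subseteq X$ be a closed linear subspace. If the quotient $X/Y$ is weakly Lindelöf determined or weak Asplund, then $Y$ is $w^*$-extensible in $X$.
   Context: For a Banach space $Z$, $Z^*$ is its topological dual, $B_{Z^*}$ is the closed unit ball of $Z^*$, and $w^*$ denotes the weak$^*$ topology on $Z^*$. A closed linear subspace $Y\subseteq X$ is $w^*$-extensible in $X$ if for every $w^*$-convergent sequence $(y_n^* )_{n\in\mathbb{N}}$ in $Y^*$ there exist a subsequence $(y_{n_k}^* )_{k\in\mathbb{N}}$ and a $w^*$-convergent sequence $(x_k^* )_{k\in\mathbb{N}}$ in $X^*$ such that $x_k^*|_Y=y_{n_k}^*$ for all $k\in\mathbb{N}$. A compact Hausdorff space is Corson compact if it is homeomorphic to a subset of $\{x\in\mathbb{R}^\Gamma : \{\gamma\in\Gamma : x(\gamma)\neq 0\} \text{ is countable}\}$ (with the product topology) for some set $\Gamma$. A Banach space $Z$ is weakly Lindelöf determined if $(B_{Z^*},w^* )$ is Corson compact. A Banach space $Z$ is weak Asplund if every continuous convex function $f:U\to\mathbb{R}$ defined on a non-empty open convex set $U\subseteq Z$ is Gâteaux differentiable at every point of some dense $G_\delta$ subset of $U$. *)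

theory Defs
  imports "HOL-Analysis.Analysis"
begin

text \<open>
  The quotient of a Banach space by a subspace given as a set is not a type, so real normed
  spaces are represented with an explicit carrier.  All values of the operations outside the
  carrier are irrelevant.
\<close>

record 'v normed_structure =
  vecs :: "'v set"
  vadd :: "'v \<Rightarrow> 'v \<Rightarrow> 'v"
  vscale :: "real \<Rightarrow> 'v \<Rightarrow> 'v"
  vnorm :: "'v \<Rightarrow> real"

definition subspace_structure :: "'a::real_normed_vector set \<Rightarrow> 'a normed_structure" where
  "subspace_structure Y = \<lparr>vecs = Y, vadd = (+), vscale = scaleR, vnorm = norm\<rparr>"

text \<open>
  Cosets are sets of vectors.  In the scalar multiplication the summand \<open>y\<close> only matters for
  \<open>c = 0\<close>, where the result must be the coset \<open>Y\<close> rather than \<open>{0}\<close>.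
\<close>

definition quotient_structure :: "'a::real_normed_vector set \<Rightarrow> 'a set normed_structure" where
  "quotient_structure Y =
    \<lparr>vecs = range (\<lambda>x. {x + y |y. y \<in> Y}),
     vadd = (\<lambda>A B. {a + b |a b. a \<in> A \<and> b \<in> B}),
     vscale = (\<lambda>c A. {c *\<^sub>R a + y |a y. a \<in> A \<and> y \<in> Y}),
     vnorm = (\<lambda>A. Inf (norm ` A))\<rparr>"

text \<open>The case distinction is needed because \<^locale>\<open>Metric_space\<close> constrains the distance
  function also outside the carrier.\<close>

definition vdist :: "'v normed_structure \<Rightarrow> 'v \<Rightarrow> 'v \<Rightarrow> real" where
  "vdist Z x z =
    (if x \<in> vecs Z \<and> z \<in> vecs Z then vnorm Z (vadd Z x (vscale Z (-1) z)) else 0)"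

definition norm_topology :: "'v normed_structure \<Rightarrow> 'v topology" where
  "norm_topology Z = Metric_space.mtopology (vecs Z) (vdist Z)"

text \<open>Functionals are normalised to be \<^const>\<open>undefined\<close> outside the carrier, as the points of
  \<^const>\<open>product_topology\<close> are.\<close>

definition dual_space :: "'v normed_structure \<Rightarrow> ('v \<Rightarrow> real) set" where
  "dual_space Z = {f \<in> extensional (vecs Z).
     (\<forall>x\<in>vecs Z. \<forall>z\<in>vecs Z. f (vadd Z x z) = f x + f z) \<and>
     (\<forall>c. \<forall>x\<in>vecs Z. f (vscale Z c x) = c * f x) \<and>
     (\<exists>B. \<forall>x\<in>vecs Z. \<bar>f x\<bar> \<le> B * vnorm Z x)}"

definition dual_norm :: "'v normed_structure \<Rightarrow> ('v \<Rightarrow> real) \<Rightarrow> real" where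
  "dual_norm Z f = (SUP x\<in>{x \<in> vecs Z. vnorm Z x \<le> 1}. \<bar>f x\<bar>)"

definition dual_ball :: "'v normed_structure \<Rightarrow> ('v \<Rightarrow> real) set" where
  "dual_ball Z = {f \<in> dual_space Z. dual_norm Z f \<le> 1}"

definition weak_star :: "'v normed_structure \<Rightarrow> ('v \<Rightarrow> real) topology" where
  "weak_star Z = subtopology (product_topology (\<lambda>_. euclideanreal) (vecs Z)) (dual_space Z)"

definition wstar_extensible :: "'v set \<Rightarrow> 'v normed_structure \<Rightarrow> bool" where
  "wstar_extensible Y X \<longleftrightarrow>
    (\<forall>(y :: nat \<Rightarrow> 'v \<Rightarrow> real) y0.
       range y \<subseteq> dual_space (X\<lparr>vecs := Y\<rparr>) \<and> limitin (weak_star (X\<lparr>vecs := Y\<rparr>)) y y0 sequentially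
       \<longrightarrow> (\<exists>(r :: nat \<Rightarrow> nat) (x :: nat \<Rightarrow> 'v \<Rightarrow> real) x0.
             strict_mono r \<and>
             range x \<subseteq> dual_space X \<and> limitin (weak_star X) x x0 sequentially \<and>
             (\<forall>k. restrict (x k) Y = y (r k))))"

definition sigma_product :: "'g set \<Rightarrow> ('g \<Rightarrow> real) set" where
  "sigma_product \<Gamma> = {x \<in> extensional \<Gamma>. countable {\<gamma> \<in> \<Gamma>. x \<gamma> \<noteq> 0}}"

text \<open>
  The index set ranges over sets of functions on \<open>K\<close>.  This loses no generality (see
  \<open>corson_compactI\<close> below): for an embedding into a \<open>\<Sigma>\<close>-product over an index set of any type,
  the indices can be replaced by the corresponding coordinate functions on \<open>K\<close>.
\<close>

definition corson_compact :: "'k topology \<Rightarrow> bool" where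
  "corson_compact K \<longleftrightarrow> compact_space K \<and> Hausdorff_space K \<and>
    (\<exists>(\<Gamma> :: ('k \<Rightarrow> real) set) S. S \<subseteq> sigma_product \<Gamma> \<and>
       K homeomorphic_space subtopology (product_topology (\<lambda>_. euclideanreal) \<Gamma>) S)"

lemma corson_compactI:
  fixes K :: "'k topology" and \<Gamma> :: "'g set"
  assumes K: "compact_space K" "Hausdorff_space K"
    and S: "S \<subseteq> sigma_product \<Gamma>"
    and hom: "K homeomorphic_space subtopology (product_topology (\<lambda>_. euclideanreal) \<Gamma>) S"
  shows "corson_compact K"
proof -
  obtain h where h: "homeomorphic_map K (subtopology (product_topology (\<lambda>_. euclideanreal) \<Gamma>) S) h"
    using hom by (auto simp: homeomorphic_space)
  have cont: "continuous_map K (product_topology (\<lambda>_. euclideanreal) \<Gamma>) h"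
    using homeomorphic_imp_continuous_map[OF h] continuous_map_in_subtopology by blast
  have hS: "h k \<in> S" if "k \<in> topspace K" for k
    using homeomorphic_imp_surjective_map[OF h] that by auto
  have inj: "inj_on h (topspace K)"
    using homeomorphic_imp_injective_map[OF h] .
  have ext: "h k \<in> extensional \<Gamma>" if "k \<in> topspace K" for k
    using hS[OF that] S by (auto simp: sigma_product_def)
  define \<phi> where "\<phi> \<gamma> = restrict (\<lambda>k. h k \<gamma>) (topspace K)" for \<gamma>
  define e where "e k = restrict (\<lambda>g. g k) (\<phi> ` \<Gamma>)" for k
  have \<phi>_cont: "continuous_map K euclideanreal (\<phi> \<gamma>)" if "\<gamma> \<in> \<Gamma>" for \<gamma>
  proof -
    have "continuous_map K euclideanreal (\<lambda>k. h k \<gamma>)"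
      using cont that by (simp add: continuous_map_componentwise)
    then show ?thesis
      by (rule continuous_map_eq) (simp add: \<phi>_def)
  qed
  have e_cont: "continuous_map K (product_topology (\<lambda>_. euclideanreal) (\<phi> ` \<Gamma>)) e"
    using \<phi>_cont by (auto simp: continuous_map_componentwise e_def)
  have e_inj: "inj_on e (topspace K)"
  proof (rule inj_onI)
    fix k k' assume k: "k \<in> topspace K" "k' \<in> topspace K" and eq: "e k = e k'"
    have "h k \<gamma> = h k' \<gamma>" if "\<gamma> \<in> \<Gamma>" for \<gamma>
      using fun_cong[OF eq, of "\<phi> \<gamma>"] that k by (simp add: e_def \<phi>_def)
    then have "h k = h k'"
      using ext k by (auto intro: extensionalityI)
    then show "k = k'" using inj k by (auto dest: inj_onD)
  qed
  have e_sigma: "e ` topspace K \<subseteq> sigma_product (\<phi> ` \<Gamma>)"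
  proof safe
    fix k assume k: "k \<in> topspace K"
    have "countable {\<gamma> \<in> \<Gamma>. h k \<gamma> \<noteq> 0}"
      using hS[OF k] S by (auto simp: sigma_product_def)
    moreover have "{g \<in> \<phi> ` \<Gamma>. e k g \<noteq> 0} \<subseteq> \<phi> ` {\<gamma> \<in> \<Gamma>. h k \<gamma> \<noteq> 0}"
    proof
      fix g assume "g \<in> {g \<in> \<phi> ` \<Gamma>. e k g \<noteq> 0}"
      then obtain \<gamma> where \<gamma>: "\<gamma> \<in> \<Gamma>" "g = \<phi> \<gamma>" "e k g \<noteq> 0" by blast
      then have "e k g = h k \<gamma>" using k by (simp add: e_def \<phi>_def)
      with \<gamma> have "\<gamma> \<in> {\<gamma> \<in> \<Gamma>. h k \<gamma> \<noteq> 0}" by simp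
      with \<gamma>(2) show "g \<in> \<phi> ` {\<gamma> \<in> \<Gamma>. h k \<gamma> \<noteq> 0}" by (rule image_eqI)
    qed
    ultimately have "countable {g \<in> \<phi> ` \<Gamma>. e k g \<noteq> 0}"
      by (meson countable_image countable_subset)
    then show "e k \<in> sigma_product (\<phi> ` \<Gamma>)"
      by (simp add: sigma_product_def e_def)
  qed
  let ?T = "subtopology (product_topology (\<lambda>_. euclideanreal) (\<phi> ` \<Gamma>)) (e ` topspace K)"
  have "homeomorphic_map K ?T e"
  proof (rule continuous_imp_homeomorphic_map)
    show "continuous_map K ?T e"
      using e_cont by (auto simp: continuous_map_in_subtopology)
    show "Hausdorff_space ?T"
      by (simp add: Hausdorff_space_subtopology Hausdorff_space_product_topology)
    show "e ` topspace K = topspace ?T"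
      using continuous_map_image_subset_topspace[OF e_cont] by auto
  qed (use K e_inj in auto)
  then show ?thesis
    using K e_sigma unfolding corson_compact_def homeomorphic_space by blast
qed

definition weakly_lindelof_determined :: "'v normed_structure \<Rightarrow> bool" where
  "weakly_lindelof_determined Z \<longleftrightarrow> corson_compact (subtopology (weak_star Z) (dual_ball Z))"

definition vconvex :: "'v normed_structure \<Rightarrow> 'v set \<Rightarrow> bool" where
  "vconvex Z U \<longleftrightarrow>
    (\<forall>x\<in>U. \<forall>z\<in>U. \<forall>t\<in>{0..1}. vadd Z (vscale Z (1 - t) x) (vscale Z t z) \<in> U)"

definition vconvex_on :: "'v normed_structure \<Rightarrow> 'v set \<Rightarrow> ('v \<Rightarrow> real) \<Rightarrow> bool" where
  "vconvex_on Z U f \<longleftrightarrow>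
    (\<forall>x\<in>U. \<forall>z\<in>U. \<forall>t\<in>{0..1}.
       f (vadd Z (vscale Z (1 - t) x) (vscale Z t z)) \<le> (1 - t) * f x + t * f z)"

definition gateaux_differentiable_at :: "'v normed_structure \<Rightarrow> ('v \<Rightarrow> real) \<Rightarrow> 'v \<Rightarrow> bool" where
  "gateaux_differentiable_at Z f x \<longleftrightarrow>
    (\<exists>g\<in>dual_space Z. \<forall>v\<in>vecs Z.
       ((\<lambda>t. (f (vadd Z x (vscale Z t v)) - f x) / t) \<longlongrightarrow> g v) (at 0))"

definition weak_asplund :: "'v normed_structure \<Rightarrow> bool" where
  "weak_asplund Z \<longleftrightarrow>
    (\<forall>U f. openin (norm_topology Z) U \<and> U \<noteq> {} \<and> vconvex Z U \<and>
       continuous_map (subtopology (norm_topology Z) U) euclideanreal f \<and> vconvex_on Z U f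
       \<longrightarrow> (\<exists>D. gdelta_in (subtopology (norm_topology Z) U) D \<and>
             subtopology (norm_topology Z) U closure_of D = U \<and>
             (\<forall>x\<in>D. gateaux_differentiable_at Z f x)))"

end

theory Submission
  imports Defs
begin

text \<open>
  Subtracting the limit, assume \<open>y\<^sub>n \<rightarrow> 0\<close> in the weak-star topology of \<open>Y\<^sup>*\<close>.  By uniform boundedness
  and Hahn--Banach the \<open>y\<^sub>n\<close> extend to a bounded sequence \<open>e\<^sub>n\<close> in \<open>X\<^sup>*\<close>, and its set \<open>L\<close> of
  weak-star cluster points is a non-empty compact subset of the annihilator of \<open>Y\<close>, which is the
  dual of \<open>X/Y\<close>.  If \<open>L\<close> has a point \<open>l\<close> that is determined within \<open>L\<close> by its values on countably
  many vectors (a \<open>G\<^sub>\<delta>\<close> point of \<open>L\<close>), a diagonal choice gives a subsequence of \<open>e\<^sub>n\<close> converging to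
  \<open>l\<close> on those vectors; all its cluster points then coincide with \<open>l\<close>, so by compactness it
  converges to \<open>l\<close>.

  Such a point exists in both cases.  If \<open>L\<close> embeds in a \<open>\<Sigma>\<close>-product, a maximal element for the
  coordinatewise order of positive and negative parts is determined by its countable support.  If
  \<open>X/Y\<close> is weak Asplund, the support function of \<open>L\<close> has a point of Gateaux differentiability
  \<open>x\<^sub>0\<close>, and then only one element of \<open>L\<close> attains the maximum at \<open>x\<^sub>0\<close>.
\<close>

section \<open>Hahn--Banach\<close>

text \<open>Homogeneity is only an inequality, which is what has to be checked for the infima built
  below; \<open>sublinear_scale\<close> upgrades it to an equality.\<close>

definition sublinear :: "('a::real_vector \<Rightarrow> real) \<Rightarrow> bool" where
  "sublinear p \<longleftrightarrow> (\<forall>x y. p (x + y) \<le> p x + p y) \<and> (\<forall>c>0. \<forall>x. p (c *\<^sub>R x) \<le> c * p x)"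

lemma sublinear_add: "sublinear p \<Longrightarrow> p (x + y) \<le> p x + p y"
  by (simp add: sublinear_def)

lemma sublinear_scale:
  assumes "sublinear p" "c > 0" shows "p (c *\<^sub>R x) = c * p x"
proof -
  have "p ((1/c) *\<^sub>R (c *\<^sub>R x)) \<le> (1/c) * p (c *\<^sub>R x)"
    using assms unfolding sublinear_def by (meson zero_less_divide_1_iff)
  then have "c * p x \<le> p (c *\<^sub>R x)" using assms(2) by (simp add: field_simps)
  then show ?thesis using assms by (simp add: sublinear_def order.antisym)
qed

lemma sublinear_zero: "sublinear p \<Longrightarrow> p 0 = 0"
  using sublinear_scale[of p 2 0] by simp

lemma sublinear_minus: "sublinear p \<Longrightarrow> - p (- x) \<le> p x"
  using sublinear_add[of p x "- x"] sublinear_zero[of p] by simp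

text \<open>The witness is the infimal convolution of \<open>f\<close> on the convex cone
  \<open>S\<close> with \<open>q\<close>. It is applied to a ray, to show that minimal sublinear
  functionals are linear, and to a subspace, to extend a functional from it.\<close>

lemma sublinear_inf_convolution:
  fixes q f :: "'a::real_vector \<Rightarrow> real"
  assumes q: "sublinear q" and S0: "0 \<in> S"
    and Sadd: "\<And>y z. \<lbrakk>y \<in> S; z \<in> S\<rbrakk> \<Longrightarrow> y + z \<in> S \<and> f (y + z) \<le> f y + f z"
    and Sscale: "\<And>c y. \<lbrakk>0 < c; y \<in> S\<rbrakk> \<Longrightarrow> c *\<^sub>R y \<in> S \<and> f (c *\<^sub>R y) \<le> c * f y"
    and lower: "\<And>y. y \<in> S \<Longrightarrow> - q (- y) \<le> f y"
  obtains p where "sublinear p" "\<And>x y. y \<in> S \<Longrightarrow> p x \<le> f y + q (x - y)"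
proof
  define p where "p x = (INF y\<in>S. f y + q (x - y))" for x
  \<comment> \<open>Finiteness of the infimum: \<open>f y \<ge> - q (- y)\<close> by
    \<open>lower\<close>, and \<open>q (- y) \<le> q (x - y) + q (- x)\<close>.\<close>
  have "bdd_below ((\<lambda>y. f y + q (x - y)) ` S)" for x
  proof (rule bdd_belowI2)
    fix y assume "y \<in> S"
    then show "- q (- x) \<le> f y + q (x - y)"
      using lower[of y] sublinear_add[OF q, of "x - y" "- x"] by simp
  qed
  then show le: "p x \<le> f y + q (x - y)" if "y \<in> S" for x y
    using that unfolding p_def by (intro cINF_lower)
  have ge: "a \<le> p x" if "\<And>y. y \<in> S \<Longrightarrow> a \<le> f y + q (x - y)" for a x
    using that S0 unfolding p_def by (intro cINF_greatest) auto
  have "p (x + z) \<le> p x + p z" for x z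
  proof -
    have "p (x + z) - (f y + q (x - y)) \<le> p z" if y: "y \<in> S" for y
    proof (rule ge)
      fix w assume w: "w \<in> S"
      show "p (x + z) - (f y + q (x - y)) \<le> f w + q (z - w)"
        using le[of "y + w" "x + z"] Sadd[OF y w] sublinear_add[OF q, of "x - y" "z - w"]
        by (simp add: algebra_simps)
    qed
    then have "p (x + z) - p z \<le> p x"
      by (intro ge) (simp add: algebra_simps)
    then show ?thesis by simp
  qed
  moreover have "p (c *\<^sub>R x) \<le> c * p x" if c: "c > 0" for c x
  proof -
    have "p (c *\<^sub>R x) / c \<le> p x"
    proof (rule ge)
      fix y assume y: "y \<in> S"
      have "p (c *\<^sub>R x) \<le> c * f y + c * q (x - y)"
        using le[of "c *\<^sub>R y" "c *\<^sub>R x"] Sscale[OF c y] sublinear_scale[OF q c, of "x - y"]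
        by (simp add: scaleR_diff_right)
      then show "p (c *\<^sub>R x) / c \<le> f y + q (x - y)"
        using c by (simp add: field_simps)
    qed
    then show ?thesis using c by (simp add: field_simps)
  qed
  ultimately show "sublinear p" by (simp add: sublinear_def)
qed

text \<open>Zorn's lemma for the reversed pointwise order. The pointwise infimum of a non-empty
  chain is finite because each member \<open>f\<close> satisfies
  \<open>- p (- x) \<le> - f (- x) \<le> f x\<close>.\<close>

lemma sublinear_dominates_minimal:
  fixes p :: "'a::real_vector \<Rightarrow> real"
  assumes p: "sublinear p"
  obtains m where "sublinear m" "\<And>x. m x \<le> p x"
    "\<And>q x. \<lbrakk>sublinear q; \<And>x. q x \<le> m x\<rbrakk> \<Longrightarrow> q x = m x"
proof -
  define A where "A = {q. sublinear q \<and> q \<le> p}"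
  have "\<exists>m\<in>A. \<forall>a\<in>A. m \<ge> a \<longrightarrow> a = m"
  proof (rule predicate_Zorn)
    show "partial_order_on A (relation_of (\<lambda>f g. g \<le> f) A)"
      by (rule partial_order_on_relation_ofI) auto
  next
    fix C assume C: "C \<in> Chains (relation_of (\<lambda>f g. g \<le> f) A)"
    then have CA: "C \<subseteq> A" by (rule Chains_relation_of)
    have tot: "f \<le> g \<or> g \<le> f" if "f \<in> C" "g \<in> C" for f g
      using C that by (auto simp: Chains_def relation_of_def)
    show "\<exists>u\<in>A. \<forall>a\<in>C. u \<le> a"
    proof (cases "C = {}")
      case True then show ?thesis using p by (auto simp: A_def)
    next
      case False
      define u where "u x = (INF f\<in>C. f x)" for x
      have "bdd_below ((\<lambda>f. f x) ` C)" for x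
      proof (rule bdd_belowI2)
        fix f assume "f \<in> C"
        then have "sublinear f" "f (- x) \<le> p (- x)" using CA by (auto simp: A_def le_fun_def)
        then show "- p (- x) \<le> f x" using sublinear_minus[of f x] by simp
      qed
      then have le: "u x \<le> f x" if "f \<in> C" for f x
        using that unfolding u_def by (intro cINF_lower)
      have ge: "a \<le> u x" if "\<And>f. f \<in> C \<Longrightarrow> a \<le> f x" for a x
        using that False unfolding u_def by (intro cINF_greatest) auto
      have sub: "sublinear f" if "f \<in> C" for f using CA that by (auto simp: A_def)
      have "u (x + y) \<le> u x + u y" for x y
      proof -
        have "u (x + y) - f x \<le> u y" if f: "f \<in> C" for f
        proof (rule ge)
          fix g assume g: "g \<in> C"
          \<comment> \<open>Subadditivity of the infimum rests on totality of the chain: one member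
            \<open>h\<close> lies below both \<open>f\<close> and \<open>g\<close>.\<close>
          obtain h where h: "h \<in> C" "h \<le> f" "h \<le> g" using tot[OF f g] f g by blast
          have "u (x + y) \<le> h x + h y" using le[OF h(1)] sublinear_add[OF sub[OF h(1)]] order_trans by blast
          also have "\<dots> \<le> f x + g y" using h by (auto simp: le_fun_def intro: add_mono)
          finally show "u (x + y) - f x \<le> g y" by simp
        qed
        then have "u (x + y) - u y \<le> u x" by (intro ge) (simp add: algebra_simps)
        then show ?thesis by simp
      qed
      moreover have "u (c *\<^sub>R x) \<le> c * u x" if c: "c > 0" for c x
      proof -
        have "u (c *\<^sub>R x) / c \<le> u x"
        proof (rule ge)
          fix f assume f: "f \<in> C"
          show "u (c *\<^sub>R x) / c \<le> f x"
            using le[OF f, of "c *\<^sub>R x"] sublinear_scale[OF sub[OF f] c, of x] c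
            by (simp add: field_simps)
        qed
        then show ?thesis using c by (simp add: field_simps)
      qed
      ultimately have "sublinear u" by (simp add: sublinear_def)
      moreover have "u \<le> p" using False CA le unfolding A_def le_fun_def by (blast intro: order_trans)
      ultimately show ?thesis using le by (auto simp: A_def le_fun_def)
    qed
  qed
  then obtain m where "m \<in> A" and min: "\<And>a. a \<in> A \<Longrightarrow> a \<le> m \<Longrightarrow> a = m" by auto
  show ?thesis
  proof
    show "sublinear m" and mp: "m x \<le> p x" for x
      using \<open>m \<in> A\<close> by (auto simp: A_def le_fun_def)
    fix q x assume "sublinear q" "\<And>x. q x \<le> m x"
    then have "q \<in> A" "q \<le> m" using mp by (auto simp: A_def le_fun_def intro: order_trans)
    then show "q x = m x" using min by blast
  qed
qed

text \<open>A minimal sublinear functional \<open>m\<close> is linear: replacing \<open>m\<close> by the infimum of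
  \<open>m (x + t z) - t m z\<close> over \<open>t \<ge> 0\<close> gives nothing smaller, hence \<open>m x + m z \<le> m (x + z)\<close>.\<close>

theorem sublinear_dominates_linear:
  fixes p :: "'a::real_vector \<Rightarrow> real"
  assumes p: "sublinear p"
  obtains l where "linear l" "\<And>x. l x \<le> p x"
proof -
  obtain m where m: "sublinear m" and mp: "\<And>x. m x \<le> p x"
    and min: "\<And>q x. \<lbrakk>sublinear q; \<And>x. q x \<le> m x\<rbrakk> \<Longrightarrow> q x = m x"
    using sublinear_dominates_minimal[OF p] by metis
  have super: "m x + m z \<le> m (x + z)" for x z
  proof -
    \<comment> \<open>The ray spanned by \<open>- z\<close>; at its point
      \<open>- (t *\<^sub>R z)\<close> the function \<open>\<lambda>y. - m (- y)\<close> has the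
      value \<open>- t * m z\<close>.\<close>
    let ?S = "{- (t *\<^sub>R z) |t. 0 \<le> t}"
    have scale: "m (t *\<^sub>R z) = t * m z" if "t \<ge> 0" for t
      using that sublinear_scale[OF m, of t z] sublinear_zero[OF m] by (cases "t = 0") auto
    obtain q where q: "sublinear q" and le: "\<And>x y. y \<in> ?S \<Longrightarrow> q x \<le> - m (- y) + m (x - y)"
    proof (rule sublinear_inf_convolution[OF m, of ?S "\<lambda>y. - m (- y)"], goal_cases)
      case 1 then show ?case by force
    next
      case (2 y w)
      then obtain s t where y: "y = - (s *\<^sub>R z)" "s \<ge> 0" and w: "w = - (t *\<^sub>R z)" "t \<ge> 0" by blast
      have "y + w = - ((s + t) *\<^sub>R z)" using y w by (simp add: algebra_simps)
      moreover have "m ((s + t) *\<^sub>R z) = m (s *\<^sub>R z) + m (t *\<^sub>R z)"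
        using y w scale[of s] scale[of t] scale[of "s + t"] by (simp add: distrib_right)
      ultimately show ?case using y w by (force simp del: minus_add_distrib)
    next
      case (3 c y)
      then obtain s where y: "y = - (s *\<^sub>R z)" "s \<ge> 0" by blast
      have "c *\<^sub>R y = - ((c * s) *\<^sub>R z)" "0 \<le> c * s" using y 3 by auto
      moreover have "m ((c * s) *\<^sub>R z) = c * m (s *\<^sub>R z)" using y 3 by (simp add: scale)
      ultimately show ?case using y by (metis (mono_tags, lifting) add.inverse_inverse mem_Collect_eq mult_minus_right order.refl)
    next
      case (4 y) then show ?case by simp
    next
      case (5 q) then show ?case by blast
    qed
    \<comment> \<open>The parameter \<open>t = 0\<close> gives \<open>q \<le> m\<close>, so
      minimality forces equality; then \<open>t = 1\<close> yields superadditivity.\<close>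
    have "q x \<le> m x" for x using le[of 0 x] sublinear_zero[OF m] by force
    then have "q x = m x" using min q by blast
    moreover have "q x \<le> - m z + m (x + z)" using le[of "- z" x] by (force intro: exI[of _ 1])
    ultimately show ?thesis by simp
  qed
  have add: "m (x + z) = m x + m z" for x z
    using super[of x z] sublinear_add[OF m, of x z] by simp
  have "linear m"
  proof (rule linearI)
    fix c x
    have neg: "m (- x) = - m x" for x using add[of x "- x"] sublinear_zero[OF m] by simp
    show "m (c *\<^sub>R x) = c *\<^sub>R m x"
    proof (cases c "0::real" rule: linorder_cases)
      case less
      then show ?thesis using sublinear_scale[OF m, of "- c" x] neg[of "c *\<^sub>R x"] by simp
    qed (use sublinear_scale[OF m] sublinear_zero[OF m] in auto)
  qed (rule add)
  then show ?thesis using that mp by blast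
qed

text \<open>Let \<open>p\<close> be the infimal convolution of \<open>f\<close> on \<open>Y\<close>
  with \<open>M * norm x\<close>, and \<open>l\<close> a linear functional below \<open>p\<close>.
  The choice \<open>y = 0\<close> gives the norm bound, and \<open>x = y\<close> gives
  \<open>l \<le> f\<close> on \<open>Y\<close>; applying both to negatives turns them into the
  two-sided bound and equality.\<close>

theorem bounded_extension:
  fixes Y :: "'a::real_normed_vector set"
  assumes Y: "subspace Y" and "0 \<le> M"
    and add: "\<And>x y. \<lbrakk>x \<in> Y; y \<in> Y\<rbrakk> \<Longrightarrow> f (x + y) = f x + f y"
    and scale: "\<And>c x. x \<in> Y \<Longrightarrow> f (c *\<^sub>R x) = c * f x"
    and bound: "\<And>y. y \<in> Y \<Longrightarrow> \<bar>f y\<bar> \<le> M * norm y"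
  obtains l where "linear l" "\<And>x. \<bar>l x\<bar> \<le> M * norm x" "\<And>y. y \<in> Y \<Longrightarrow> l y = f y"
proof -
  have q: "sublinear (\<lambda>x. M * norm x)"
    using \<open>0 \<le> M\<close> by (auto simp: sublinear_def norm_triangle_ineq mult_left_mono simp flip: distrib_left)
  obtain p where p: "sublinear p" and le: "\<And>x y. y \<in> Y \<Longrightarrow> p x \<le> f y + M * norm (x - y)"
  proof (rule sublinear_inf_convolution[OF q, of Y f], goal_cases)
    case (4 y) then show ?case using bound[of y] by simp
  next
    case (5 p) then show ?case by blast
  qed (use Y add scale in \<open>auto simp: subspace_0 subspace_add subspace_scale\<close>)
  obtain l where l: "linear l" and lp: "\<And>x. l x \<le> p x" using sublinear_dominates_linear[OF p] by blast
  have f0: "f 0 = 0" using scale[of 0 0] subspace_0[OF Y] by simp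
  have upper: "l x \<le> M * norm x" for x
    using lp[of x] le[OF subspace_0[OF Y], of x] f0 by simp
  have lY: "l y \<le> f y" if "y \<in> Y" for y using lp[of y] le[OF that, of y] by simp
  show ?thesis
  proof
    show "\<bar>l x\<bar> \<le> M * norm x" for x
      using upper[of x] upper[of "- x"] linear_neg[OF l, of x] by simp
    show "l y = f y" if y: "y \<in> Y" for y
      using lY[OF y] lY[of "- y"] subspace_neg[OF Y y] linear_neg[OF l, of y] scale[OF y, of "- 1"]
      by simp
  qed (rule l)
qed

section \<open>Uniform boundedness on a closed subspace\<close>

text \<open>Baire category in the closed, hence completely metrizable, subspace \<open>Y\<close>:
  one of the closed sets \<open>A k\<close> contains a relative ball, which is translated to the
  origin and rescaled.\<close>

theorem uniform_boundedness:
  fixes Y :: "'a::banach set" and f :: "'i \<Rightarrow> 'a \<Rightarrow> real"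
  assumes Y: "subspace Y" "closed Y"
    and add: "\<And>n x y. \<lbrakk>x \<in> Y; y \<in> Y\<rbrakk> \<Longrightarrow> f n (x + y) = f n x + f n y"
    and scale: "\<And>n c x. x \<in> Y \<Longrightarrow> f n (c *\<^sub>R x) = c * f n x"
    and bound: "\<And>n. \<exists>B. \<forall>y\<in>Y. \<bar>f n y\<bar> \<le> B * norm y"
    and pointwise: "\<And>y. y \<in> Y \<Longrightarrow> \<exists>B. \<forall>n. \<bar>f n y\<bar> \<le> B"
  obtains M where "0 < M" "\<And>n y. y \<in> Y \<Longrightarrow> \<bar>f n y\<bar> \<le> M * norm y"
proof -
  have diff: "f n (x - y) = f n x - f n y" if "x \<in> Y" "y \<in> Y" for n x y
    using add[of x "- y" n] scale[of y n "- 1"] subspace_neg[OF Y(1)] that by simp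
  have cont: "continuous_on Y (f n)" for n
  proof -
    obtain B where B: "\<And>y. y \<in> Y \<Longrightarrow> \<bar>f n y\<bar> \<le> B * norm y" using bound by blast
    have "\<bar>B\<bar>-lipschitz_on Y (f n)"
    proof (rule lipschitz_onI)
      fix x y assume xy: "x \<in> Y" "y \<in> Y"
      have "\<bar>f n (x - y)\<bar> \<le> B * norm (x - y)" using B xy subspace_diff[OF Y(1)] by blast
      also have "\<dots> \<le> \<bar>B\<bar> * norm (x - y)" by (intro mult_right_mono) auto
      finally show "dist (f n x) (f n y) \<le> \<bar>B\<bar> * dist x y"
        using diff xy by (simp add: dist_norm)
    qed simp
    then show ?thesis by (rule lipschitz_on_continuous_on)
  qed
  define A where "A k = {y \<in> Y. \<forall>n. \<bar>f n y\<bar> \<le> real k}" for k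
  have closed: "closedin (top_of_set Y) (A k)" for k
  proof -
    have "closedin (top_of_set Y) (Y \<inter> f n -` {- real k..real k})" for n
      by (intro continuous_closedin_preimage cont) auto
    then have "closedin (top_of_set Y) (\<Inter>n. Y \<inter> f n -` {- real k..real k})"
      by (intro closedin_INT) auto
    also have "(\<Inter>n. Y \<inter> f n -` {- real k..real k}) = A k" by (auto simp: A_def abs_le_iff minus_le_iff)
    finally show ?thesis .
  qed
  have "(\<Union>k. A k) = Y"
  proof -
    have "\<exists>k. y \<in> A k" if y: "y \<in> Y" for y
    proof -
      obtain B where "\<forall>n. \<bar>f n y\<bar> \<le> B" using pointwise[OF y] by blast
      moreover obtain k where "B \<le> real k" using real_arch_simple by blast
      ultimately show ?thesis using y by (auto simp: A_def intro: order_trans)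
    qed
    then show ?thesis by (auto simp: A_def)
  qed
  \<comment> \<open>The union of the \<open>A k\<close> is the whole space \<open>Y\<close>, its own
    interior, so by Baire not every \<open>A k\<close> can have empty interior.\<close>
  then have ne: "top_of_set Y interior_of (\<Union>(range A)) \<noteq> {}"
    using interior_of_topspace[of "top_of_set Y"] subspace_0[OF Y(1)] by auto
  have "completely_metrizable_space (top_of_set Y)"
    using Y(2) by (simp add: completely_metrizable_space_closedin completely_metrizable_space_euclidean)
  then have "\<exists>k. top_of_set Y interior_of (A k) \<noteq> {}"
    using Baire_category_alt[of "top_of_set Y" "range A"] ne closed by auto
  then obtain k y0 where "y0 \<in> top_of_set Y interior_of (A k)" by blast
  then obtain U where U: "openin (top_of_set Y) U" "y0 \<in> U" "U \<subseteq> A k" by (auto simp: interior_of_def)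
  then obtain d where d: "d > 0" "ball y0 d \<inter> Y \<subseteq> A k" and y0: "y0 \<in> Y"
    by (metis openin_contains_ball openin_subset subsetD subset_trans topspace_euclidean_subtopology)
  have small: "\<bar>f n y\<bar> \<le> 2 * real k" if "y \<in> Y" "norm y < d" for n y
  proof -
    have "y0 + y \<in> A k" "y0 \<in> A k"
      using d that y0 subspace_add[OF Y(1)] by (auto simp: dist_norm intro!: subsetD[OF d(2)])
    then have "\<bar>f n (y0 + y)\<bar> \<le> k" "\<bar>f n y0\<bar> \<le> k" by (auto simp: A_def)
    then show ?thesis using add[OF y0 that(1), of n] by linarith
  qed
  show ?thesis
  proof
    \<comment> \<open>One factor 2 comes from translating by \<open>y0\<close>, the other from
      scaling \<open>y\<close> to norm \<open>d / 2\<close>, inside the open ball. The summand 1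
      keeps the constant positive when \<open>k = 0\<close>.\<close>
    show "0 < (4 * real k + 1) / d" using d by simp
    fix n y assume y: "y \<in> Y"
    show "\<bar>f n y\<bar> \<le> (4 * real k + 1) / d * norm y"
    proof (cases "y = 0")
      case True
      then show ?thesis using scale[OF y, of n 0] by simp
    next
      case False
      define c where "c = d / (2 * norm y)"
      have c: "c > 0" using d False by (simp add: c_def)
      have "norm (c *\<^sub>R y) < d" using d False by (simp add: c_def)
      then have "\<bar>f n (c *\<^sub>R y)\<bar> \<le> 2 * real k" using small y subspace_scale[OF Y(1)] by blast
      then have "c * \<bar>f n y\<bar> \<le> 2 * real k" using scale[OF y] c by (simp add: abs_mult)
      then have "d * \<bar>f n y\<bar> \<le> 4 * real k * norm y" using False by (simp add: c_def field_simps)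
      also have "\<dots> \<le> (4 * real k + 1) * norm y" by (intro mult_right_mono) auto
      finally show ?thesis using d by (simp add: field_simps)
    qed
  qed
qed

section \<open>Points determined by countably many coordinates\<close>

lemma cluster_point_subsequence:
  fixes e :: "nat \<Rightarrow> 'i \<Rightarrow> real"
  defines "L \<equiv> (\<Inter>m. closure (e ` {m..}))"
  assumes K: "compact K" "\<And>n. e n \<in> K"
    and l: "l \<in> L" and C: "countable C"
    and determined: "\<And>c. \<lbrakk>c \<in> L; \<forall>x\<in>C. c x = l x\<rbrakk> \<Longrightarrow> c = l"
  obtains r where "strict_mono r" "(\<lambda>k. e (r k)) \<longlonglongrightarrow> l"
proof -
  obtain a :: "nat \<Rightarrow> 'i" where a: "C \<subseteq> range a"
    using C by (metis countableE_bij empty_subsetI range_from_nat_into subset_refl)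
  have "continuous_on UNIV (\<lambda>f::'i \<Rightarrow> real. \<bar>f x - l x\<bar>)" for x
    by (intro continuous_intros continuous_on_product_then_coordinatewise) 
  note cont = this
  \<comment> \<open>\<open>P k n\<close>: the function \<open>e n\<close> is within
    \<open>1 / (k + 1)\<close> of \<open>l\<close> at the first \<open>k + 1\<close> points of the
    enumeration \<open>a\<close>, whose range contains \<open>C\<close>.\<close>
  define P where "P k n \<longleftrightarrow> (\<forall>i\<le>k. \<bar>e n (a i) - l (a i)\<bar> < 1 / Suc k)" for k n
  have near: "\<exists>n\<ge>m. P k n" for m k
  proof -
    have "open (\<Inter>i\<in>{..k}. {f. \<bar>f (a i) - l (a i)\<bar> < 1 / Suc k})"
      by (intro open_INT ballI open_Collect_less cont continuous_on_const) auto
    moreover have "l \<in> closure (e ` {m..})" using l by (auto simp: L_def)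
    ultimately obtain f where "f \<in> e ` {m..}" "f \<in> (\<Inter>i\<in>{..k}. {f. \<bar>f (a i) - l (a i)\<bar> < 1 / Suc k})"
      using open_Int_closure_eq_empty[of "\<Inter>i\<in>{..k}. {f. \<bar>f (a i) - l (a i)\<bar> < 1 / Suc k}" "e ` {m..}"] 
      by (fastforce simp: disjoint_iff)
    then show ?thesis by (auto simp: P_def)
  qed
  have "\<exists>r. \<forall>k. P k (r k) \<and> r k < r (Suc k)"
  proof (rule dependent_nat_choice)
    show "\<exists>n. P 0 n" using near by blast
    show "\<exists>n'. P (Suc k) n' \<and> n < n'" for n k using near[of "Suc n" "Suc k"] by auto
  qed
  then obtain r where r: "\<And>k. P k (r k)" and mono: "strict_mono r" by (auto simp: strict_mono_Suc_iff)
  have "(\<lambda>k. e (r k)) \<longlonglongrightarrow> l"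
  proof (rule topological_tendstoI, rule ccontr)
    fix U assume U: "open U" "l \<in> U" and not: "\<not> (\<forall>\<^sub>F k in sequentially. e (r k) \<in> U)"
    have ex: "\<exists>k\<ge>m. e (r k) \<notin> U" for m using not by (auto simp: eventually_sequentially)
    \<comment> \<open>If the subsequence leaves \<open>U\<close> infinitely often, compactness of
      \<open>K - U\<close> provides a cluster point \<open>c\<close> of it outside \<open>U\<close>.
      The rest shows that \<open>c\<close> agrees with \<open>l\<close> on \<open>C\<close>, so that
      \<open>c = l\<close>, a contradiction.\<close>
    have "(K - U) \<inter> (\<Inter>m. closure ((\<lambda>k. e (r k)) ` {m..})) \<noteq> {}"
    proof (rule compact_imp_fip_image)
      show "compact (K - U)" using K U by (simp add: compact_diff)
      fix I :: "nat set" assume "finite I"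
      then obtain b where b: "\<And>i. i \<in> I \<Longrightarrow> i \<le> b" by (meson finite_nat_set_iff_bounded_le)
      obtain k where k: "k \<ge> b" "e (r k) \<notin> U" using ex by blast
      have "e (r k) \<in> closure ((\<lambda>k. e (r k)) ` {i..})" if "i \<in> I" for i
        using b[OF that] k by (intro subsetD[OF closure_subset]) auto
      then show "(K - U) \<inter> (\<Inter>m\<in>I. closure ((\<lambda>k. e (r k)) ` {m..})) \<noteq> {}"
        using k K by blast
    qed simp
    then obtain c where c: "c \<notin> U" "\<And>m. c \<in> closure ((\<lambda>k. e (r k)) ` {m..})" by blast
    have "c \<in> L"
    proof -
      \<comment> \<open>Since \<open>r k \<ge> k\<close>, tails of the subsequence lie in tails of
        \<open>e\<close>.\<close>
      have "(\<lambda>k. e (r k)) ` {m..} \<subseteq> e ` {m..}" for m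
        using seq_suble[OF mono] by (auto intro!: imageI intro: order_trans)
      then show ?thesis using c closure_mono unfolding L_def by blast
    qed
    moreover have "c (a i) = l (a i)" for i
    proof -
      have "\<bar>c (a i) - l (a i)\<bar> \<le> 1 / Suc k" if "k \<ge> i" for k
      proof -
        have "(\<lambda>k. e (r k)) ` {k..} \<subseteq> {f. \<bar>f (a i) - l (a i)\<bar> \<le> 1 / Suc k}"
        proof clarify
          fix j assume "k \<le> j"
          then have "\<bar>e (r j) (a i) - l (a i)\<bar> < 1 / Suc j" using r[of j] that by (auto simp: P_def)
          also have "\<dots> \<le> 1 / Suc k" using \<open>k \<le> j\<close> by (simp add: field_simps)
          finally show "\<bar>e (r j) (a i) - l (a i)\<bar> \<le> 1 / Suc k" by simp
        qed
        moreover have "closed {f. \<bar>f (a i) - l (a i)\<bar> \<le> 1 / Suc k}"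
          by (intro closed_Collect_le cont continuous_on_const)
        ultimately show ?thesis using closure_minimal c(2)[of k] by blast
      qed
      moreover have "(\<lambda>k. 1 / real (Suc k)) \<longlonglongrightarrow> 0" using lim_1_over_n LIMSEQ_Suc by blast
      ultimately have "\<bar>c (a i) - l (a i)\<bar> \<le> 0"
        by (intro LIMSEQ_le_const) auto
      then show ?thesis by simp
    qed
    ultimately have "c = l" using a by (intro determined) auto
    then show False using c U by blast
  qed
  then show ?thesis using mono that by blast
qed

text \<open>Tails of \<open>e\<close> lie in closed sets where \<open>\<phi>\<close> is close to
  \<open>a\<close>. This transfers linearity and vanishing on \<open>Y\<close> to cluster
  points.\<close>

lemma cluster_point_limit:
  fixes e :: "nat \<Rightarrow> 'b::topological_space" and \<phi> :: "'b \<Rightarrow> real"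
  assumes c: "c \<in> (\<Inter>m. closure (e ` {m..}))" and cont: "continuous_on UNIV \<phi>"
    and lim: "(\<lambda>n. \<phi> (e n)) \<longlonglongrightarrow> a"
  shows "\<phi> c = a"
proof -
  have "\<bar>\<phi> c - a\<bar> \<le> \<epsilon>" if \<epsilon>: "\<epsilon> > 0" for \<epsilon>
  proof -
    obtain m where "\<And>n. n \<ge> m \<Longrightarrow> \<bar>\<phi> (e n) - a\<bar> < \<epsilon>" using LIMSEQ_D[OF lim \<epsilon>] by auto
    then have "e ` {m..} \<subseteq> {f. \<bar>\<phi> f - a\<bar> \<le> \<epsilon>}" by (auto intro: less_imp_le)
    moreover have "closed {f. \<bar>\<phi> f - a\<bar> \<le> \<epsilon>}"
      by (intro closed_Collect_le continuous_intros cont)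
    ultimately show ?thesis using c closure_minimal by blast
  qed
  then have "\<bar>\<phi> c - a\<bar> \<le> 0" by (rule field_le_epsilon) simp
  then show ?thesis by simp
qed

text \<open>A basic neighbourhood in the product topology restricts only finitely many coordinates.
  Taking one for each tolerance \<open>1 / (n + 1)\<close> gives a countable union. This later
  converts coordinates of a Sigma-product into evaluations at vectors.\<close>

lemma continuous_determined_countably:
  fixes \<phi> :: "('i \<Rightarrow> real) \<Rightarrow> real"
  assumes "continuous_on L \<phi>" "l \<in> L"
  obtains C where "countable C" "\<And>c. \<lbrakk>c \<in> L; \<forall>x\<in>C. c x = l x\<rbrakk> \<Longrightarrow> \<phi> c = \<phi> l"
proof -
  have "\<exists>F. finite F \<and> (\<forall>c\<in>L. (\<forall>x\<in>F. c x = l x) \<longrightarrow> \<bar>\<phi> c - \<phi> l\<bar> < 1 / Suc n)" for n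
  proof -
    have "openin (top_of_set L) (L \<inter> \<phi> -` ball (\<phi> l) (1 / Suc n))"
      using assms by (intro continuous_openin_preimage_gen) auto
    then obtain U where U: "open U" "L \<inter> \<phi> -` ball (\<phi> l) (1 / Suc n) = L \<inter> U"
      by (auto simp: openin_open)
    have "l \<in> L \<inter> \<phi> -` ball (\<phi> l) (1 / Suc n)" using assms by simp
    then have "l \<in> U" unfolding U(2) by blast
    then obtain X where X: "finite {i. X i \<noteq> UNIV}" "l \<in> Pi\<^sub>E UNIV X" "Pi\<^sub>E UNIV X \<subseteq> U"
      using U(1) unfolding open_fun_def openin_product_topology_alt by auto
    have "\<bar>\<phi> c - \<phi> l\<bar> < 1 / Suc n" if c: "c \<in> L" "\<forall>x\<in>{i. X i \<noteq> UNIV}. c x = l x" for c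
    proof -
      have "c x \<in> X x" for x using X(2) c(2) by (cases "X x = UNIV") (auto simp: PiE_iff)
      then have "c \<in> L \<inter> \<phi> -` ball (\<phi> l) (1 / Suc n)" using X(3) c unfolding U(2) by (auto simp: PiE_iff)
      then show ?thesis by (simp add: dist_real_def abs_minus_commute)
    qed
    then show ?thesis using X(1) by blast
  qed
  then obtain F where F: "\<And>n. finite (F n)"
    "\<And>n c. \<lbrakk>c \<in> L; \<forall>x\<in>F n. c x = l x\<rbrakk> \<Longrightarrow> \<bar>\<phi> c - \<phi> l\<bar> < 1 / Suc n" by metis
  show ?thesis
  proof
    show "countable (\<Union>n. F n)" using F(1) by (simp add: countable_finite)
    fix c assume "c \<in> L" "\<forall>x\<in>(\<Union>n. F n). c x = l x"
    then have "\<bar>\<phi> c - \<phi> l\<bar> < 1 / Suc n" for n using F(2) by blast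
    then have "\<bar>\<phi> c - \<phi> l\<bar> \<le> 0" using nat_approx_posE by (metis linorder_not_le order_less_asym)
    then show "\<phi> c = \<phi> l" by simp
  qed
qed

section \<open>Maximal points of compact sets in Sigma-products\<close>

text \<open>Zorn's lemma for the coordinatewise order, antisymmetric by \<open>inj\<close>. For a
  chain, the sets of upper bounds of single members are closed in \<open>L\<close> and have the
  finite intersection property, so compactness gives a common upper bound.\<close>

lemma compact_has_maximal:
  fixes g :: "'l::topological_space \<Rightarrow> 'j \<Rightarrow> real"
  assumes L: "compact L" "L \<noteq> {}" "closed L" and cont: "\<And>j. j \<in> J \<Longrightarrow> continuous_on L (\<lambda>l. g l j)"
    and inj: "\<And>l l'. \<lbrakk>l \<in> L; l' \<in> L; \<forall>j\<in>J. g l j = g l' j\<rbrakk> \<Longrightarrow> l = l'"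
  obtains l where "l \<in> L" "\<And>c. \<lbrakk>c \<in> L; \<forall>j\<in>J. g l j \<le> g c j\<rbrakk> \<Longrightarrow> c = l"
proof -
  define R where "R l c \<longleftrightarrow> (\<forall>j\<in>J. g l j \<le> g c j)" for l c
  have "\<exists>m\<in>L. \<forall>a\<in>L. R m a \<longrightarrow> a = m"
  proof (rule predicate_Zorn)
    show "partial_order_on L (relation_of R L)"
      by (rule partial_order_on_relation_ofI)
        (auto simp: R_def intro: order_trans intro!: inj order.antisym)
  next
    fix C assume C: "C \<in> Chains (relation_of R L)"
    then have CL: "C \<subseteq> L" by (rule Chains_relation_of)
    have tot: "R f g \<or> R g f" if "f \<in> C" "g \<in> C" for f g
      using C that by (auto simp: Chains_def relation_of_def)
    have trans: "R a b \<Longrightarrow> R b c \<Longrightarrow> R a c" for a b c by (auto simp: R_def intro: order_trans)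
    have fin: "\<exists>u\<in>L. \<forall>a\<in>D. R a u" if "finite D" "D \<subseteq> C" for D
    proof -
      have "D \<noteq> {} \<longrightarrow> (\<exists>u\<in>D. \<forall>a\<in>D. R a u)"
        using that
      proof (induction D)
        case (insert x D)
        show ?case
        proof (cases "D = {}")
          case True then show ?thesis by (auto simp: R_def)
        next
          case False
          then obtain u where u: "u \<in> D" "\<forall>a\<in>D. R a u" using insert by blast
          have "R x u \<or> R u x" using tot u insert by blast
          moreover have "R x x" by (simp add: R_def)
          ultimately show ?thesis using u trans by blast
        qed
      qed simp
      then show ?thesis using L that CL by blast
    qed
    have "L \<inter> (\<Inter>a\<in>C. {u \<in> L. R a u}) \<noteq> {}"
    proof (rule compact_imp_fip_image[OF L(1)])
      fix a assume "a \<in> C"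
      have "closed (L \<inter> (\<lambda>u. g u j) -` {g a j..})" if "j \<in> J" for j
        using that by (intro continuous_closed_preimage cont closed_atLeast L(3))
      then have "closed (L \<inter> (\<Inter>j\<in>J. L \<inter> (\<lambda>u. g u j) -` {g a j..}))"
        using L(3) by (intro closed_Int closed_INT) auto
      also have "L \<inter> (\<Inter>j\<in>J. L \<inter> (\<lambda>u. g u j) -` {g a j..}) = {u \<in> L. R a u}"
        by (auto simp: R_def)
      finally show "closed {u \<in> L. R a u}" .
    next
      fix D assume "finite D" "D \<subseteq> C"
      then show "L \<inter> (\<Inter>a\<in>D. {u \<in> L. R a u}) \<noteq> {}" using fin[of D] by blast
    qed
    then show "\<exists>u\<in>L. \<forall>a\<in>C. R a u" by blast
  qed
  then show ?thesis using that unfolding R_def by blast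
qed

text \<open>Let \<open>l\<close> be maximal for the order on positive and negative parts. If
  \<open>c\<close> agrees with \<open>l\<close> on the countable support of \<open>l\<close>, then
  \<open>c\<close> dominates \<open>l\<close>: off the support both parts of \<open>l\<close> are 0
  and those of \<open>c\<close> are non-negative.\<close>

lemma sigma_compact_has_determined_point:
  fixes h :: "'l::topological_space \<Rightarrow> 'g \<Rightarrow> real"
  assumes L: "compact L" "L \<noteq> {}" "closed L" and cont: "\<And>\<gamma>. \<gamma> \<in> \<Gamma> \<Longrightarrow> continuous_on L (\<lambda>l. h l \<gamma>)"
    and inj: "\<And>l l'. \<lbrakk>l \<in> L; l' \<in> L; \<forall>\<gamma>\<in>\<Gamma>. h l \<gamma> = h l' \<gamma>\<rbrakk> \<Longrightarrow> l = l'"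
    and supp: "\<And>l. l \<in> L \<Longrightarrow> countable {\<gamma> \<in> \<Gamma>. h l \<gamma> \<noteq> 0}"
  obtains l \<Delta> where "l \<in> L" "\<Delta> \<subseteq> \<Gamma>" "countable \<Delta>"
    "\<And>c. \<lbrakk>c \<in> L; \<forall>\<gamma>\<in>\<Delta>. h c \<gamma> = h l \<gamma>\<rbrakk> \<Longrightarrow> c = l"
proof -
  \<comment> \<open>The Boolean component selects the positive part (\<open>True\<close>) or the
    negative part (\<open>False\<close>) of the coordinate.\<close>
  define g where "g l j = (if snd j then max 0 (h l (fst j)) else max 0 (- h l (fst j)))" for l j
  obtain l where l: "l \<in> L" and max: "\<And>c. \<lbrakk>c \<in> L; \<forall>j\<in>\<Gamma> \<times> UNIV. g l j \<le> g c j\<rbrakk> \<Longrightarrow> c = l"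
  proof (rule compact_has_maximal[OF L, of "\<Gamma> \<times> UNIV" g])
    fix j :: "'g \<times> bool" assume "j \<in> \<Gamma> \<times> UNIV"
    then have "continuous_on L (\<lambda>l. h l (fst j))" using cont by auto
    then show "continuous_on L (\<lambda>l. g l j)"
      by (cases "snd j") (auto simp: g_def intro!: continuous_on_max continuous_on_minus continuous_on_const)
  next
    fix l l' assume ll: "l \<in> L" "l' \<in> L" and eq: "\<forall>j\<in>\<Gamma> \<times> UNIV. g l j = g l' j"
    show "l = l'"
    proof (rule inj[OF ll], rule ballI)
      fix \<gamma> assume "\<gamma> \<in> \<Gamma>"
      then have "g l (\<gamma>, True) = g l' (\<gamma>, True)" "g l (\<gamma>, False) = g l' (\<gamma>, False)" using eq by auto
      then show "h l \<gamma> = h l' \<gamma>" by (auto simp: g_def max_def split: if_splits)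
    qed
  qed blast
  show ?thesis
  proof
    fix c assume c: "c \<in> L" "\<forall>\<gamma>\<in>{\<gamma> \<in> \<Gamma>. h l \<gamma> \<noteq> 0}. h c \<gamma> = h l \<gamma>"
    then show "c = l" by (intro max) (auto simp: g_def max_def)
  qed (use l supp in auto)
qed

section \<open>The quotient and its dual\<close>

text \<open>\<open>infdist x Y\<close> is the quotient norm of the coset of \<open>x\<close>; this
  is its triangle inequality.\<close>

lemma infdist_subspace_add:
  fixes Y :: "'a::real_normed_vector set"
  assumes Y: "subspace Y"
  shows "infdist (x + z) Y \<le> infdist x Y + infdist z Y"
proof -
  have ne: "Y \<noteq> {}" using subspace_0[OF Y] by blast
  have "infdist (x + z) Y \<le> dist x y + dist z w" if "y \<in> Y" "w \<in> Y" for y w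
    using infdist_le[of "y + w" Y "x + z"] subspace_add[OF Y that] dist_triangle_add[of x z y w]
    by linarith
  then have "infdist (x + z) Y - dist x y \<le> infdist z Y" if "y \<in> Y" for y
    unfolding infdist_notempty[OF ne, of z] using ne that
    by (intro cINF_greatest) (auto simp: algebra_simps)
  then have "infdist (x + z) Y - infdist z Y \<le> infdist x Y"
    unfolding infdist_notempty[OF ne, of x] using ne
    by (intro cINF_greatest) (auto simp: algebra_simps)
  then show ?thesis by simp
qed

lemma infdist_subspace_minus:
  fixes Y :: "'a::real_normed_vector set"
  assumes Y: "subspace Y"
  shows "infdist (- x) Y = infdist x Y"
proof -
  have ne: "Y \<noteq> {}" using subspace_0[OF Y] by blast
  have "infdist (- x) Y \<le> infdist x Y" for x
    unfolding infdist_notempty[OF ne, of x] using ne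
  proof (intro cINF_greatest)
    fix y assume "y \<in> Y"
    then show "infdist (- x) Y \<le> dist x y"
      using infdist_le[of "- y" Y "- x"] subspace_neg[OF Y] by (simp add: dist_minus)
  qed
  from this[of x] this[of "- x"] show ?thesis by simp
qed

text \<open>The quotient map, named so that the operations of \<open>quotient_structure\<close> can
  be computed on representatives.\<close>

definition coset_of :: "'a::real_normed_vector set \<Rightarrow> 'a \<Rightarrow> 'a set" where
  "coset_of Y x = {x + y |y. y \<in> Y}"

lemma coset_of_eq_iff:
  assumes Y: "subspace Y"
  shows "coset_of Y x = coset_of Y z \<longleftrightarrow> x - z \<in> Y"
proof
  assume "coset_of Y x = coset_of Y z"
  moreover have "x \<in> coset_of Y x" using subspace_0[OF Y] by (force simp: coset_of_def)
  ultimately show "x - z \<in> Y" by (auto simp: coset_of_def)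
next
  assume d: "x - z \<in> Y"
  have "coset_of Y a \<subseteq> coset_of Y b" if "a - b \<in> Y" for a b
  proof
    fix u assume "u \<in> coset_of Y a"
    then obtain y where "y \<in> Y" "u = a + y" by (auto simp: coset_of_def)
    then have "u = b + (a - b + y)" "a - b + y \<in> Y" using subspace_add[OF Y that] by auto
    then show "u \<in> coset_of Y b" unfolding coset_of_def by blast
  qed
  from this[OF d] this[of z x] show "coset_of Y x = coset_of Y z"
    using subspace_neg[OF Y d] by auto
qed

lemma vecs_quotient: "vecs (quotient_structure Y) = range (coset_of Y)"
  by (auto simp: quotient_structure_def coset_of_def)

lemma vadd_quotient:
  assumes Y: "subspace Y"
  shows "vadd (quotient_structure Y) (coset_of Y x) (coset_of Y z) = coset_of Y (x + z)"
proof -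
  have "{a + b |a b. a \<in> coset_of Y x \<and> b \<in> coset_of Y z} = coset_of Y (x + z)" (is "?L = ?R")
  proof
    show "?L \<subseteq> ?R"
    proof clarify
      fix a b assume "a \<in> coset_of Y x" "b \<in> coset_of Y z"
      then obtain y w where "y \<in> Y" "w \<in> Y" "a = x + y" "b = z + w" by (auto simp: coset_of_def)
      then have "a + b = (x + z) + (y + w)" "y + w \<in> Y" using subspace_add[OF Y] by auto
      then show "a + b \<in> ?R" unfolding coset_of_def by blast
    qed
    show "?R \<subseteq> ?L"
    proof
      fix u assume "u \<in> ?R"
      then obtain y where y: "y \<in> Y" "u = x + z + y" by (auto simp: coset_of_def)
      then have "u = (x + y) + (z + 0)" by simp
      then show "u \<in> ?L" using y(1) subspace_0[OF Y] unfolding coset_of_def by blast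
    qed
  qed
  then show ?thesis by (simp add: quotient_structure_def)
qed

lemma vscale_quotient:
  assumes Y: "subspace Y"
  shows "vscale (quotient_structure Y) c (coset_of Y x) = coset_of Y (c *\<^sub>R x)"
proof -
  have "{c *\<^sub>R a + y |a y. a \<in> coset_of Y x \<and> y \<in> Y} = coset_of Y (c *\<^sub>R x)" (is "?L = ?R")
  proof
    show "?L \<subseteq> ?R"
    proof clarify
      fix a y assume "a \<in> coset_of Y x" and y: "y \<in> Y"
      then obtain w where "w \<in> Y" "a = x + w" by (auto simp: coset_of_def)
      then have "c *\<^sub>R a + y = c *\<^sub>R x + (c *\<^sub>R w + y)" "c *\<^sub>R w + y \<in> Y"
        using y subspace_add[OF Y] subspace_scale[OF Y] by (auto simp: algebra_simps)
      then show "c *\<^sub>R a + y \<in> ?R" unfolding coset_of_def by blast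
    qed
    show "?R \<subseteq> ?L"
    proof
      fix u assume "u \<in> ?R"
      then obtain y where "y \<in> Y" "u = c *\<^sub>R x + y" by (auto simp: coset_of_def)
      moreover have "x \<in> coset_of Y x" using subspace_0[OF Y] by (force simp: coset_of_def)
      ultimately show "u \<in> ?L" by blast
    qed
  qed
  then show ?thesis by (simp add: quotient_structure_def)
qed

lemma vnorm_quotient:
  assumes Y: "subspace Y"
  shows "vnorm (quotient_structure Y) (coset_of Y x) = infdist x Y"
proof -
  have ne: "Y \<noteq> {}" using subspace_0[OF Y] by blast
  have "norm ` coset_of Y x = dist x ` Y"
  proof -
    have "coset_of Y x = (\<lambda>y. x - y) ` Y"
    proof -
      have "x + y = x - (- y)" "x - y = x + (- y)" for y by simp_all
      then show ?thesis unfolding coset_of_def using subspace_neg[OF Y] by blast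
    qed
    then show ?thesis by (simp add: image_image dist_norm)
  qed
  then show ?thesis by (simp add: quotient_structure_def infdist_notempty[OF ne])
qed

lemma vdist_quotient:
  assumes Y: "subspace Y"
  shows "vdist (quotient_structure Y) (coset_of Y x) (coset_of Y z) = infdist (x - z) Y"
  by (simp add: vdist_def vecs_quotient vscale_quotient[OF Y] vadd_quotient[OF Y] vnorm_quotient[OF Y])

text \<open>Closedness of \<open>Y\<close> makes cosets at distance 0 equal. The case splits treat
  the default value 0 of \<open>vdist\<close> outside the carrier.\<close>

lemma Metric_space_quotient:
  fixes Y :: "'a::real_normed_vector set"
  assumes Y: "subspace Y" "closed Y"
  shows "Metric_space (vecs (quotient_structure Y)) (vdist (quotient_structure Y))"
proof
  let ?d = "vdist (quotient_structure Y)"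
  note vd = vdist_quotient[OF Y(1)]
  have sym: "infdist (x - z) Y = infdist (z - x) Y" for x z :: 'a
    using infdist_subspace_minus[OF Y(1), of "x - z"] by simp
  show "0 \<le> ?d A B" for A B
  proof (cases "A \<in> vecs (quotient_structure Y) \<and> B \<in> vecs (quotient_structure Y)")
    case True then show ?thesis by (auto simp: vecs_quotient vd infdist_nonneg)
  next
    case False
    then have "?d A B = 0" unfolding vdist_def by (rule if_not_P)
    then show ?thesis by simp
  qed
  show "?d A B = ?d B A" for A B
  proof (cases "A \<in> vecs (quotient_structure Y) \<and> B \<in> vecs (quotient_structure Y)")
    case True then show ?thesis by (auto simp: vecs_quotient vd sym)
  next
    case False
    then have "?d A B = 0" "?d B A = 0" unfolding vdist_def by (auto intro!: if_not_P)
    then show ?thesis by simp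
  qed
  show "?d A B = 0 \<longleftrightarrow> A = B"
    if AB: "A \<in> vecs (quotient_structure Y)" "B \<in> vecs (quotient_structure Y)" for A B
  proof -
    obtain x z where "A = coset_of Y x" "B = coset_of Y z" using AB by (auto simp: vecs_quotient)
    moreover have "Y \<noteq> {}" using subspace_0[OF Y(1)] by blast
    ultimately show ?thesis
      using in_closed_iff_infdist_zero[OF Y(2), of "x - z"] by (simp add: vd coset_of_eq_iff[OF Y(1)])
  qed
  show "?d A D \<le> ?d A B + ?d B D"
    if ABD: "A \<in> vecs (quotient_structure Y)" "B \<in> vecs (quotient_structure Y)"
      "D \<in> vecs (quotient_structure Y)" for A B D
  proof -
    obtain x z w where "A = coset_of Y x" "B = coset_of Y z" "D = coset_of Y w"
      using ABD by (auto simp: vecs_quotient)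
    then show ?thesis using infdist_subspace_add[OF Y(1), of "x - z" "z - w"] by (simp add: vd)
  qed
qed

section \<open>The annihilator of \<open>Y\<close> as the dual of the quotient\<close>

text \<open>For \<open>M > 0\<close> this is a copy of the ball of radius \<open>M\<close> in the
  dual of the quotient, kept as functions on the whole type so that the product topology of
  functions serves as the weak-star topology.\<close>

definition annihilator_ball :: "'a::real_normed_vector set \<Rightarrow> real \<Rightarrow> ('a \<Rightarrow> real) set" where
  "annihilator_ball Y M = {l. linear l \<and> (\<forall>y\<in>Y. l y = 0) \<and> (\<forall>x. \<bar>l x\<bar> \<le> M * norm x)}"

text \<open>\<open>l\<close> takes the same value at \<open>x\<close> and \<open>x - y\<close> for
  every \<open>y \<in> Y\<close>, so the norm bound may be minimised over the coset.\<close>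

lemma annihilator_ball_infdist:
  assumes Y: "subspace Y" and l: "l \<in> annihilator_ball Y M" and "0 < M"
  shows "\<bar>l x\<bar> \<le> M * infdist x Y"
proof -
  have ne: "Y \<noteq> {}" using subspace_0[OF Y] by blast
  have "\<bar>l x\<bar> / M \<le> infdist x Y"
    unfolding infdist_notempty[OF ne]
  proof (intro cINF_greatest ne)
    fix y assume "y \<in> Y"
    then have "l (x - y) = l x" using l by (simp add: annihilator_ball_def linear_diff)
    moreover have "\<bar>l (x - y)\<bar> \<le> M * norm (x - y)"
      using l unfolding annihilator_ball_def by blast
    ultimately show "\<bar>l x\<bar> / M \<le> dist x y" using \<open>0 < M\<close> by (simp add: dist_norm field_simps)
  qed
  then show ?thesis using \<open>0 < M\<close> by (simp add: field_simps)
qed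

text \<open>Independent of the representative chosen by \<open>SOME\<close> only if \<open>f\<close> is constant on cosets.\<close>

definition on_quotient :: "'a::real_normed_vector set \<Rightarrow> ('a \<Rightarrow> real) \<Rightarrow> 'a set \<Rightarrow> real" where
  "on_quotient Y f = (\<lambda>A\<in>range (coset_of Y). f (SOME x. coset_of Y x = A))"

lemma on_quotient_coset:
  assumes "subspace Y" "\<And>x z. x - z \<in> Y \<Longrightarrow> f x = f z"
  shows "on_quotient Y f (coset_of Y x) = f x"
proof -
  have "coset_of Y (SOME z. coset_of Y z = coset_of Y x) = coset_of Y x"
    by (rule someI) simp
  then have "(SOME z. coset_of Y z = coset_of Y x) - x \<in> Y"
    by (simp only: coset_of_eq_iff[OF assms(1)])
  then show ?thesis using assms(2) by (simp add: on_quotient_def)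
qed

lemma annihilator_ball_quotient:
  assumes "subspace Y" "l \<in> annihilator_ball Y M"
  shows "on_quotient Y l (coset_of Y x) = l x"
proof (rule on_quotient_coset[OF assms(1)])
  fix x z assume "x - z \<in> Y"
  then have "l (x - z) = 0" using assms(2) by (auto simp: annihilator_ball_def)
  then show "l x = l z" using assms(2) by (simp add: annihilator_ball_def linear_diff)
qed

lemma annihilator_ball_dual_ball:
  assumes Y: "subspace Y" and l: "l \<in> annihilator_ball Y 1"
  shows "on_quotient Y l \<in> dual_ball (quotient_structure Y)"
proof -
  let ?Q = "quotient_structure Y"
  note q = annihilator_ball_quotient[OF Y l]
  have lin: "linear l" using l by (simp add: annihilator_ball_def)
  have bound: "\<bar>l x\<bar> \<le> infdist x Y" for x using annihilator_ball_infdist[OF Y l] by simp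
  have "on_quotient Y l \<in> dual_space ?Q"
    unfolding dual_space_def
  proof (intro CollectI conjI)
    show "on_quotient Y l \<in> extensional (vecs ?Q)" by (simp add: on_quotient_def vecs_quotient)
    show "\<exists>B. \<forall>x\<in>vecs ?Q. \<bar>on_quotient Y l x\<bar> \<le> B * vnorm ?Q x"
      using bound by (intro exI[of _ 1]) (auto simp: vecs_quotient q vnorm_quotient[OF Y])
  qed (auto simp: vecs_quotient vadd_quotient[OF Y] vscale_quotient[OF Y] q
      linear_add[OF lin] linear_scale[OF lin])
  moreover have "dual_norm ?Q (on_quotient Y l) \<le> 1"
    unfolding dual_norm_def
  proof (rule cSUP_least)
    have "coset_of Y 0 \<in> {x \<in> vecs ?Q. vnorm ?Q x \<le> 1}"
      using subspace_0[OF Y] by (simp add: vecs_quotient vnorm_quotient[OF Y] infdist_zero)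
    then show "{x \<in> vecs ?Q. vnorm ?Q x \<le> 1} \<noteq> {}" by blast
    fix A assume "A \<in> {x \<in> vecs ?Q. vnorm ?Q x \<le> 1}"
    then show "\<bar>on_quotient Y l A\<bar> \<le> 1"
      using bound order_trans by (fastforce simp: vecs_quotient q vnorm_quotient[OF Y])
  qed
  ultimately show ?thesis by (simp add: dual_ball_def)
qed

section \<open>Determined points in the dual of the quotient\<close>

text \<open>A rescaled copy of \<open>L\<close> lies in the dual ball of the quotient and hence
  embeds in a Sigma-product, where some point is determined by countably many coordinates. Each of
  these is continuous on \<open>L\<close> and so depends near that point on countably many vectors
  in the sense of \<open>continuous_determined_countably\<close>.\<close>

lemma weakly_lindelof_determined_imp_determined_point:
  assumes Y: "subspace Y" and wld: "weakly_lindelof_determined (quotient_structure Y)"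
    and L: "compact L" "L \<noteq> {}" "closed L" "L \<subseteq> annihilator_ball Y M" and M: "0 < M"
  obtains l C where "l \<in> L" "countable C" "\<And>c. \<lbrakk>c \<in> L; \<forall>x\<in>C. c x = l x\<rbrakk> \<Longrightarrow> c = l"
proof -
  let ?Q = "quotient_structure Y"
  let ?T = "subtopology (weak_star ?Q) (dual_ball ?Q)"
  let ?P = "\<lambda>\<Gamma>. product_topology (\<lambda>_. euclideanreal) \<Gamma>"
  obtain \<Gamma> :: "(('a set \<Rightarrow> real) \<Rightarrow> real) set" and S where S: "S \<subseteq> sigma_product \<Gamma>"
    and "?T homeomorphic_space subtopology (?P \<Gamma>) S"
    using wld unfolding weakly_lindelof_determined_def corson_compact_def by blast
  then obtain h where h: "homeomorphic_map ?T (subtopology (?P \<Gamma>) S) h"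
    by (auto simp: homeomorphic_space)
  \<comment> \<open>Division by \<open>M\<close> moves \<open>L\<close> into the unit ball before
    passing to the quotient.\<close>
  define j where "j l = on_quotient Y (\<lambda>x. l x / M)" for l
  have scaled: "(\<lambda>x. l x / M) \<in> annihilator_ball Y 1" if "l \<in> L" for l
  proof -
    have l: "linear l" "\<forall>y\<in>Y. l y = 0" "\<forall>x. \<bar>l x\<bar> \<le> M * norm x"
      using L(4) that by (auto simp: annihilator_ball_def)
    have "linear (\<lambda>x. l x / M)"
      using l(1) by (intro linearI) (simp_all add: linear_add linear_scale add_divide_distrib)
    then show ?thesis using l M by (simp add: annihilator_ball_def field_simps)
  qed
  have jl: "j l (coset_of Y x) = l x / M" if "l \<in> L" for l x
    unfolding j_def using annihilator_ball_quotient[OF Y scaled[OF that]] .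
  have jball: "j l \<in> dual_ball ?Q" if "l \<in> L" for l
    unfolding j_def by (rule annihilator_ball_dual_ball[OF Y scaled[OF that]])
  have "continuous_map (top_of_set L) (?P (vecs ?Q)) j"
    unfolding continuous_map_componentwise
  proof (intro conjI ballI)
    show "j ` topspace (top_of_set L) \<subseteq> extensional (vecs ?Q)"
      by (auto simp: j_def on_quotient_def vecs_quotient)
    fix A assume "A \<in> vecs ?Q"
    then obtain x where A: "A = coset_of Y x" by (auto simp: vecs_quotient)
    have "continuous_on L (\<lambda>l. l x / M)"
      using M by (intro continuous_on_divide continuous_on_const
          continuous_on_subset[OF continuous_on_product_coordinates]) auto
    then have "continuous_map (top_of_set L) euclideanreal (\<lambda>l. l x / M)" by simp
    then show "continuous_map (top_of_set L) euclideanreal (\<lambda>l. j l A)"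
      by (rule continuous_map_eq) (simp add: A jl)
  qed
  then have jcont: "continuous_map (top_of_set L) ?T j"
    using jball by (auto simp: weak_star_def continuous_map_in_subtopology dual_ball_def)
  then have jtop: "j l \<in> topspace ?T" if "l \<in> L" for l
    using that continuous_map_image_subset_topspace by fastforce
  have hcont: "continuous_map (top_of_set L) (?P \<Gamma>) (h \<circ> j)"
    using continuous_map_compose[OF jcont homeomorphic_imp_continuous_map[OF h]]
    by (simp add: continuous_map_in_subtopology)
  have hS: "h (j l) \<in> sigma_product \<Gamma>" if "l \<in> L" for l
    using homeomorphic_imp_surjective_map[OF h] jtop[OF that] S by auto
  obtain l \<Delta> where l: "l \<in> L" "\<Delta> \<subseteq> \<Gamma>" "countable \<Delta>"
    and det: "\<And>c. \<lbrakk>c \<in> L; \<forall>\<gamma>\<in>\<Delta>. h (j c) \<gamma> = h (j l) \<gamma>\<rbrakk> \<Longrightarrow> c = l"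
  proof (rule sigma_compact_has_determined_point[OF L(1,2,3), of \<Gamma> "\<lambda>l. h (j l)"])
    fix \<gamma> assume "\<gamma> \<in> \<Gamma>"
    then show "continuous_on L (\<lambda>l. h (j l) \<gamma>)"
      using hcont by (auto simp: continuous_map_componentwise)
  next
    fix l l' assume ll: "l \<in> L" "l' \<in> L" and eq: "\<forall>\<gamma>\<in>\<Gamma>. h (j l) \<gamma> = h (j l') \<gamma>"
    have "h (j l) = h (j l')"
      using hS[OF ll(1)] hS[OF ll(2)] eq by (auto simp: sigma_product_def intro: extensionalityI)
    then have "j l = j l'"
      using homeomorphic_imp_injective_map[OF h] jtop ll by (auto dest: inj_onD)
    then have "l x / M = l' x / M" for x using jl ll by metis
    then show "l = l'" using M by auto
  next
    fix l assume "l \<in> L"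
    then show "countable {\<gamma> \<in> \<Gamma>. h (j l) \<gamma> \<noteq> 0}" using hS by (auto simp: sigma_product_def)
  qed blast
  have "\<exists>C. countable C \<and> (\<forall>c\<in>L. (\<forall>x\<in>C. c x = l x) \<longrightarrow> h (j c) \<gamma> = h (j l) \<gamma>)" if "\<gamma> \<in> \<Delta>" for \<gamma>
  proof -
    have "continuous_on L (\<lambda>l. h (j l) \<gamma>)"
      using hcont that l(2) by (auto simp: continuous_map_componentwise)
    from continuous_determined_countably[OF this l(1)] show ?thesis by metis
  qed
  then obtain C where C: "\<And>\<gamma>. \<gamma> \<in> \<Delta> \<Longrightarrow> countable (C \<gamma>)"
    "\<And>\<gamma> c. \<lbrakk>\<gamma> \<in> \<Delta>; c \<in> L; \<forall>x\<in>C \<gamma>. c x = l x\<rbrakk> \<Longrightarrow> h (j c) \<gamma> = h (j l) \<gamma>" by metis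
  show ?thesis
  proof
    show "countable (\<Union>\<gamma>\<in>\<Delta>. C \<gamma>)" using C(1) l(3) by blast
    fix c assume "c \<in> L" "\<forall>x\<in>(\<Union>\<gamma>\<in>\<Delta>. C \<gamma>). c x = l x"
    then show "c = l" using det C(2) by blast
  qed (rule l(1))
qed

text \<open>The support function of \<open>L\<close> descends to a convex Lipschitz function on the
  quotient. Where it is Gateaux differentiable, every element of \<open>L\<close> attaining the
  supremum equals the derivative, so the value at that one vector determines the point.\<close>

lemma weak_asplund_imp_determined_point:
  fixes Y :: "'a::real_normed_vector set"
  assumes Y: "subspace Y" "closed Y" and wa: "weak_asplund (quotient_structure Y)"
    and L: "compact L" "L \<noteq> {}" "closed L" "L \<subseteq> annihilator_ball Y M" and M: "0 < M"
  obtains l x0 where "l \<in> L" "\<And>c. \<lbrakk>c \<in> L; c x0 = l x0\<rbrakk> \<Longrightarrow> c = l"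
proof -
  let ?Q = "quotient_structure Y"
  interpret Q: Metric_space "vecs ?Q" "vdist ?Q" by (rule Metric_space_quotient[OF Y])
  have lin: "linear l" if "l \<in> L" for l using that L(4) by (auto simp: annihilator_ball_def)
  define \<sigma> where "\<sigma> x = (SUP l\<in>L. l x)" for x
  have cont: "continuous_on L (\<lambda>l. l x)" for x
    by (rule continuous_on_subset[OF continuous_on_product_coordinates]) simp
  have "bdd_above ((\<lambda>l. l x) ` L)" for x
    using compact_continuous_image[OF cont L(1)] by (simp add: bounded_imp_bdd_above compact_imp_bounded)
  then have upper: "l x \<le> \<sigma> x" if "l \<in> L" for l x
    using that unfolding \<sigma>_def by (intro cSUP_upper)
  have least: "\<sigma> x \<le> a" if "\<And>l. l \<in> L \<Longrightarrow> l x \<le> a" for x a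
    using that L(2) unfolding \<sigma>_def by (intro cSUP_least)
  have attained: "\<exists>l\<in>L. l x = \<sigma> x" for x
  proof -
    obtain l where "l \<in> L" "\<forall>c\<in>L. c x \<le> l x" using continuous_attains_sup[OF L(1,2) cont] by blast
    then show ?thesis using upper least by (metis order.antisym)
  qed
  \<comment> \<open>The estimate uses the quotient distance, so it yields both constancy of
    \<open>\<sigma>\<close> on cosets and continuity of the induced \<open>F\<close>.\<close>
  have lip1: "\<sigma> x - \<sigma> z \<le> M * infdist (x - z) Y" for x z
  proof -
    have "\<sigma> x \<le> \<sigma> z + M * infdist (x - z) Y"
    proof (rule least)
      fix l assume l: "l \<in> L"
      have "l x - l z \<le> M * infdist (x - z) Y"
        using annihilator_ball_infdist[OF Y(1) _ M, of l "x - z"] l L(4) linear_diff[OF lin[OF l], of x z]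
        by fastforce
      then show "l x \<le> \<sigma> z + M * infdist (x - z) Y" using upper[OF l, of z] by simp
    qed
    then show ?thesis by simp
  qed
  have lip: "\<bar>\<sigma> x - \<sigma> z\<bar> \<le> M * infdist (x - z) Y" for x z
    using lip1[of x z] lip1[of z x] infdist_subspace_minus[OF Y(1), of "x - z"] by simp
  define F where "F = on_quotient Y \<sigma>"
  have F: "F (coset_of Y x) = \<sigma> x" for x
    unfolding F_def
  proof (rule on_quotient_coset[OF Y(1)])
    fix x z assume "x - z \<in> Y"
    then show "\<sigma> x = \<sigma> z" using lip[of x z] by simp
  qed
  have top: "norm_topology ?Q = Q.mtopology" by (simp add: norm_topology_def)
  have sub: "subtopology (norm_topology ?Q) (vecs ?Q) = norm_topology ?Q"
    using subtopology_topspace[of "norm_topology ?Q"] by (simp add: top)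
  have "openin (norm_topology ?Q) (vecs ?Q)"
    using openin_topspace[of "norm_topology ?Q"] by (simp add: top)
  moreover have "vecs ?Q \<noteq> {}" by (simp add: vecs_quotient)
  moreover have "vconvex ?Q (vecs ?Q)"
    by (auto simp: vconvex_def vecs_quotient vscale_quotient[OF Y(1)] vadd_quotient[OF Y(1)])
  moreover have "continuous_map (subtopology (norm_topology ?Q) (vecs ?Q)) euclideanreal F"
  proof -
    have "\<exists>\<delta>>0. \<forall>B. B \<in> vecs ?Q \<and> vdist ?Q A B < \<delta> \<longrightarrow> dist (F A) (F B) < \<epsilon>"
      if A: "A \<in> vecs ?Q" and \<epsilon>: "\<epsilon> > 0" for A \<epsilon>
    proof (intro exI conjI allI impI)
      show "\<epsilon> / M > 0" using M \<epsilon> by simp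
      fix B assume "B \<in> vecs ?Q \<and> vdist ?Q A B < \<epsilon> / M"
      then obtain x z where AB: "A = coset_of Y x" "B = coset_of Y z" "vdist ?Q A B < \<epsilon> / M"
        using A by (auto simp: vecs_quotient)
      then have "M * infdist (x - z) Y < \<epsilon>" using M by (simp add: vdist_quotient[OF Y(1)] field_simps)
      then show "dist (F A) (F B) < \<epsilon>" using lip[of x z] by (simp add: AB F dist_real_def)
    qed
    then have "continuous_map Q.mtopology (Met_TC.mtopology :: real topology) F"
      by (subst Q.metric_continuous_map) (auto simp: Met_TC.Metric_space_axioms)
    then show ?thesis by (simp add: sub top)
  qed
  moreover have "vconvex_on ?Q (vecs ?Q) F"
    unfolding vconvex_on_def
  proof (intro ballI)
    fix A B and t :: real assume "A \<in> vecs ?Q" "B \<in> vecs ?Q" and t: "t \<in> {0..1}"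
    then obtain x z where AB: "A = coset_of Y x" "B = coset_of Y z" by (auto simp: vecs_quotient)
    have "\<sigma> ((1 - t) *\<^sub>R x + t *\<^sub>R z) \<le> (1 - t) * \<sigma> x + t * \<sigma> z"
    proof (rule least)
      fix l assume l: "l \<in> L"
      have "l ((1 - t) *\<^sub>R x + t *\<^sub>R z) = (1 - t) * l x + t * l z"
        using lin[OF l] by (simp add: linear_add linear_scale)
      also have "\<dots> \<le> (1 - t) * \<sigma> x + t * \<sigma> z"
        using t upper[OF l] by (intro add_mono mult_left_mono) auto
      finally show "l ((1 - t) *\<^sub>R x + t *\<^sub>R z) \<le> (1 - t) * \<sigma> x + t * \<sigma> z" .
    qed
    then show "F (vadd ?Q (vscale ?Q (1 - t) A) (vscale ?Q t B)) \<le> (1 - t) * F A + t * F B"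
      by (simp add: AB F vscale_quotient[OF Y(1)] vadd_quotient[OF Y(1)])
  qed
  ultimately have "\<exists>D. gdelta_in (norm_topology ?Q) D \<and>
      norm_topology ?Q closure_of D = vecs ?Q \<and> (\<forall>x\<in>D. gateaux_differentiable_at ?Q F x)"
    using wa[unfolded weak_asplund_def, rule_format, of "vecs ?Q" F] by (simp add: sub)
  then obtain D where D: "gdelta_in (norm_topology ?Q) D"
    "norm_topology ?Q closure_of D = vecs ?Q" "\<forall>x\<in>D. gateaux_differentiable_at ?Q F x"
    by blast
  \<comment> \<open>The closure of \<open>D\<close> is the non-empty carrier, so \<open>D\<close>
    supplies a point of differentiability.\<close>
  have "D \<noteq> {}" using D(2) by (auto simp: vecs_quotient)
  moreover have "D \<subseteq> vecs ?Q" using gdelta_in_subset[OF D(1)] by (simp add: top)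
  ultimately obtain x0 where "gateaux_differentiable_at ?Q F (coset_of Y x0)"
    using D(3) unfolding vecs_quotient by blast
  then obtain g where g: "\<And>v. ((\<lambda>t. (\<sigma> (x0 + t *\<^sub>R v) - \<sigma> x0) / t) \<longlongrightarrow> g (coset_of Y v)) (at 0)"
    by (auto simp: gateaux_differentiable_at_def vecs_quotient F vscale_quotient[OF Y(1)] vadd_quotient[OF Y(1)])
  have deriv: "l v = g (coset_of Y v)" if l: "l \<in> L" "l x0 = \<sigma> x0" for l v
  proof -
    \<comment> \<open>A maximiser \<open>l\<close> at \<open>x0\<close> is a subgradient of
      \<open>\<sigma>\<close> there. Dividing by \<open>t > 0\<close> and by \<open>t < 0\<close>
      bounds the derivative from both sides.\<close>
    have step: "t * l v \<le> \<sigma> (x0 + t *\<^sub>R v) - \<sigma> x0" for t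
      using upper[OF l(1), of "x0 + t *\<^sub>R v"] l(2) linear_add[OF lin[OF l(1)]] linear_scale[OF lin[OF l(1)]]
      by simp
    have "l v \<le> g (coset_of Y v)"
    proof (rule tendsto_lowerbound)
      show "((\<lambda>t. (\<sigma> (x0 + t *\<^sub>R v) - \<sigma> x0) / t) \<longlongrightarrow> g (coset_of Y v)) (at_right 0)"
        using g[of v] by (simp add: filterlim_at_split)
      show "\<forall>\<^sub>F t in at_right 0. l v \<le> (\<sigma> (x0 + t *\<^sub>R v) - \<sigma> x0) / t"
        using step by (auto simp: eventually_at_filter field_simps)
    qed simp
    moreover have "g (coset_of Y v) \<le> l v"
    proof (rule tendsto_upperbound)
      show "((\<lambda>t. (\<sigma> (x0 + t *\<^sub>R v) - \<sigma> x0) / t) \<longlongrightarrow> g (coset_of Y v)) (at_left 0)"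
        using g[of v] by (simp add: filterlim_at_split)
      show "\<forall>\<^sub>F t in at_left 0. (\<sigma> (x0 + t *\<^sub>R v) - \<sigma> x0) / t \<le> l v"
        using step by (auto simp: eventually_at_filter field_simps)
    qed simp
    ultimately show ?thesis by simp
  qed
  obtain l where l: "l \<in> L" "l x0 = \<sigma> x0" using attained by blast
  show ?thesis
  proof
    fix c assume "c \<in> L" "c x0 = l x0"
    then show "c = l" using deriv l by (intro ext) metis
  qed (rule l(1))
qed

section \<open>Extending weak-star convergent sequences\<close>

text \<open>Tychonoff for a product of intervals; with \<open>B x = M * norm x\<close> it supplies
  the compactness in Banach-Alaoglu.\<close>

lemma compact_bounded_functions:
  fixes B :: "'i \<Rightarrow> real"
  shows "compact {f :: 'i \<Rightarrow> real. \<forall>x. \<bar>f x\<bar> \<le> B x}"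
proof -
  have "compactin (product_topology (\<lambda>_. euclideanreal) UNIV) (Pi\<^sub>E UNIV (\<lambda>x. {- B x..B x}))"
    by (auto simp: compactin_PiE)
  moreover have "Pi\<^sub>E UNIV (\<lambda>x. {- B x..B x}) = {f. \<forall>x. \<bar>f x\<bar> \<le> B x}"
    by (auto simp: PiE_iff abs_le_iff minus_le_iff)
  ultimately show ?thesis by (simp add: euclidean_product_topology)
qed

lemma compact_cluster_set:
  fixes e :: "nat \<Rightarrow> 'b::topological_space"
  assumes K: "compact K" "\<And>n. e n \<in> K"
  shows "K \<inter> (\<Inter>m. closure (e ` {m..})) \<noteq> {}"
proof (rule compact_imp_fip_image[OF K(1)])
  fix I :: "nat set" assume "finite I"
  then obtain b where b: "\<And>i. i \<in> I \<Longrightarrow> i \<le> b" by (meson finite_nat_set_iff_bounded_le)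
  have "e b \<in> closure (e ` {i..})" if "i \<in> I" for i
    using b[OF that] by (intro subsetD[OF closure_subset]) auto
  then show "K \<inter> (\<Inter>m\<in>I. closure (e ` {m..})) \<noteq> {}" using K(2) by blast
qed simp

lemma bounded_null_on_subspace_convergent_subsequence:
  fixes Y :: "'a::real_normed_vector set" and e :: "nat \<Rightarrow> 'a \<Rightarrow> real"
  assumes Y: "subspace Y" "closed Y"
    and quot: "weakly_lindelof_determined (quotient_structure Y) \<or> weak_asplund (quotient_structure Y)"
    and lin: "\<And>n. linear (e n)" and M: "0 < M" "\<And>n x. \<bar>e n x\<bar> \<le> M * norm x"
    and null: "\<And>y. y \<in> Y \<Longrightarrow> (\<lambda>n. e n y) \<longlonglongrightarrow> 0"
  obtains r l where "strict_mono r" "l \<in> annihilator_ball Y M" "\<And>x. (\<lambda>k. e (r k) x) \<longlonglongrightarrow> l x"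
proof -
  let ?K = "{f. \<forall>x. \<bar>f x\<bar> \<le> M * norm x}"
  define L where "L = (\<Inter>m. closure (e ` {m..}))"
  have K: "compact ?K" "e n \<in> ?K" for n using compact_bounded_functions M by auto
  have coord: "continuous_on UNIV (\<lambda>f::'a \<Rightarrow> real. f x)" for x by simp
  have LK: "L \<subseteq> ?K"
  proof -
    have "closed ?K"
      by (intro closed_Collect_all closed_Collect_le continuous_on_rabs continuous_on_const
          continuous_on_product_coordinates)
    moreover have "e ` {0..} \<subseteq> ?K" using K by blast
    ultimately have "closure (e ` {0..}) \<subseteq> ?K" by (intro closure_minimal)
    then show ?thesis unfolding L_def by blast
  qed
  have "closed L" unfolding L_def by (intro closed_INT) auto
  have "compact L" using compact_Int_closed[OF K(1) \<open>closed L\<close>] LK by (simp add: inf.absorb2)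
  have "L \<noteq> {}" using compact_cluster_set[OF K(1), of e] K(2) unfolding L_def by blast
  have "L \<subseteq> annihilator_ball Y M"
  proof
    fix c assume c: "c \<in> L"
    \<comment> \<open>Linearity and vanishing on \<open>Y\<close> are expressed through finitely
      many evaluations, which are continuous, so they pass to cluster points.\<close>
    have "c (x + z) - c x - c z = 0" for x z
      by (rule cluster_point_limit[OF c[unfolded L_def], of "\<lambda>f. f (x + z) - f x - f z"])
        (auto intro!: continuous_intros coord simp: linear_add[OF lin])
    moreover have "c (t *\<^sub>R x) - t * c x = 0" for t x
      by (rule cluster_point_limit[OF c[unfolded L_def], of "\<lambda>f. f (t *\<^sub>R x) - t * f x"])
        (auto intro!: continuous_intros coord simp: linear_scale[OF lin])
    ultimately have "linear c" by (intro linearI) (simp_all add: algebra_simps)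
    moreover have "c y = 0" if "y \<in> Y" for y
      by (rule cluster_point_limit[OF c[unfolded L_def], of "\<lambda>f. f y"]) (auto simp: null[OF that])
    ultimately show "c \<in> annihilator_ball Y M" using c LK by (auto simp: annihilator_ball_def)
  qed
  note L = \<open>compact L\<close> \<open>L \<noteq> {}\<close> \<open>closed L\<close> this
  from quot obtain l C where l: "l \<in> L" "countable C" "\<And>c. \<lbrakk>c \<in> L; \<forall>x\<in>C. c x = l x\<rbrakk> \<Longrightarrow> c = l"
  proof
    assume "weakly_lindelof_determined (quotient_structure Y)"
    from weakly_lindelof_determined_imp_determined_point[OF Y(1) this L M(1)] show ?thesis
      using that by metis
  next
    assume "weak_asplund (quotient_structure Y)"
    from weak_asplund_imp_determined_point[OF Y this L M(1)] obtain l x0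
      where "l \<in> L" "\<And>c. \<lbrakk>c \<in> L; c x0 = l x0\<rbrakk> \<Longrightarrow> c = l" by metis
    then show ?thesis using that[of l "{x0}"] by simp
  qed
  obtain r where r: "strict_mono r" "(\<lambda>k. e (r k)) \<longlonglongrightarrow> l"
  proof (rule cluster_point_subsequence[OF K])
    show "l \<in> (\<Inter>m. closure (e ` {m..}))" using l(1) by (simp add: L_def)
    show "countable C" by (rule l(2))
  qed (use l(3) in \<open>auto simp: L_def\<close>)
  have "(\<lambda>k. e (r k) x) \<longlonglongrightarrow> l x" for x
    using continuous_on_tendsto_compose[OF coord r(2), of x] by simp
  then show ?thesis using that r(1) l(1) L(4) by blast
qed

text \<open>The record update is the form in which \<open>wstar_extensible\<close> presents the
  subspace; \<open>Y = UNIV\<close> gives the ambient space.\<close>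

lemma dual_space_subspace:
  "f \<in> dual_space (subspace_structure UNIV\<lparr>vecs := Y\<rparr>) \<longleftrightarrow> f \<in> extensional Y \<and>
     (\<forall>x\<in>Y. \<forall>z\<in>Y. f (x + z) = f x + f z) \<and> (\<forall>c. \<forall>x\<in>Y. f (c *\<^sub>R x) = c * f x) \<and>
     (\<exists>B. \<forall>x\<in>Y. \<bar>f x\<bar> \<le> B * norm x)"
  by (simp add: dual_space_def subspace_structure_def)

lemma limitin_weak_star_subspace:
  assumes "range f \<subseteq> dual_space (subspace_structure UNIV\<lparr>vecs := Y\<rparr>)"
  shows "limitin (weak_star (subspace_structure UNIV\<lparr>vecs := Y\<rparr>)) f g sequentially \<longleftrightarrow>
    g \<in> dual_space (subspace_structure UNIV\<lparr>vecs := Y\<rparr>) \<and> (\<forall>x\<in>Y. (\<lambda>n. f n x) \<longlonglongrightarrow> g x)"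
proof -
  let ?Z = "subspace_structure UNIV\<lparr>vecs := Y\<rparr>"
  have "f n \<in> dual_space ?Z" for n using assms by blast
  moreover have "h \<in> extensional Y" if "h \<in> dual_space ?Z" for h
    using that by (simp add: dual_space_subspace)
  moreover have "vecs ?Z = Y" by simp
  ultimately show ?thesis
    by (auto simp: weak_star_def limitin_subtopology limitin_componentwise PiE_iff)
qed

theorem corollary1p3:
  fixes Y :: "'a::banach set"
  assumes "subspace Y" and "closed Y"
    and "weakly_lindelof_determined (quotient_structure Y) \<or> weak_asplund (quotient_structure Y)"
  shows "wstar_extensible Y (subspace_structure UNIV)"
  unfolding wstar_extensible_def
proof (intro allI impI, elim conjE)
  let ?X = "subspace_structure (UNIV :: 'a set)"
  fix y :: "nat \<Rightarrow> 'a \<Rightarrow> real" and y0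
  assume y: "range y \<subseteq> dual_space (?X\<lparr>vecs := Y\<rparr>)"
    and lim: "limitin (weak_star (?X\<lparr>vecs := Y\<rparr>)) y y0 sequentially"
  note Y = assms(1,2)
  have XUNIV: "?X\<lparr>vecs := UNIV\<rparr> = ?X" by (simp add: subspace_structure_def)
  have y0: "y0 \<in> dual_space (?X\<lparr>vecs := Y\<rparr>)" and conv: "\<And>x. x \<in> Y \<Longrightarrow> (\<lambda>n. y n x) \<longlonglongrightarrow> y0 x"
    using lim unfolding limitin_weak_star_subspace[OF y] by auto
  have yn: "y n \<in> dual_space (?X\<lparr>vecs := Y\<rparr>)" for n using y by blast
  define d where "d n x = y n x - y0 x" for n x
  have dadd: "d n (x + z) = d n x + d n z" if "x \<in> Y" "z \<in> Y" for n x z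
    using yn[of n] y0 that by (simp add: dual_space_subspace d_def)
  have dscale: "d n (c *\<^sub>R x) = c * d n x" if "x \<in> Y" for n c x
    using yn[of n] y0 that by (simp add: dual_space_subspace d_def right_diff_distrib)
  have dnull: "(\<lambda>n. d n x) \<longlonglongrightarrow> 0" if "x \<in> Y" for x
    using conv[OF that] by (simp add: d_def LIM_zero)
  have dbound: "\<exists>B. \<forall>x\<in>Y. \<bar>d n x\<bar> \<le> B * norm x" for n
  proof -
    obtain B B0 where "\<forall>x\<in>Y. \<bar>y n x\<bar> \<le> B * norm x" "\<forall>x\<in>Y. \<bar>y0 x\<bar> \<le> B0 * norm x"
      using yn[of n] y0 by (auto simp: dual_space_subspace)
    then have "\<forall>x\<in>Y. \<bar>d n x\<bar> \<le> (B + B0) * norm x" by (force simp: d_def distrib_right)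
    then show ?thesis by blast
  qed
  have dpointwise: "\<exists>B. \<forall>n. \<bar>d n x\<bar> \<le> B" if "x \<in> Y" for x
    using convergent_imp_Bseq[OF convergentI[OF dnull[OF that]]] unfolding Bseq_def real_norm_def by blast
  obtain M where M: "0 < M" "\<And>n x. x \<in> Y \<Longrightarrow> \<bar>d n x\<bar> \<le> M * norm x"
    by (rule uniform_boundedness[OF Y dadd dscale dbound dpointwise]) blast+
  \<comment> \<open>Hahn-Banach with the common constant \<open>M\<close>, so that the extensions of
    the \<open>d n\<close> stay uniformly bounded.\<close>
  have "\<exists>l. linear l \<and> (\<forall>x. \<bar>l x\<bar> \<le> M * norm x) \<and> (\<forall>x\<in>Y. l x = d n x)" for n
    by (rule bounded_extension[where f = "d n", OF Y(1) less_imp_le[OF M(1)] dadd dscale M(2)]) blast+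
  then obtain e where e: "\<And>n. linear (e n)" "\<And>n x. \<bar>e n x\<bar> \<le> M * norm x"
    "\<And>n x. x \<in> Y \<Longrightarrow> e n x = d n x" by metis
  obtain B where B: "\<forall>x\<in>Y. \<bar>y0 x\<bar> \<le> B * norm x" using y0 by (auto simp: dual_space_subspace)
  have y0bound: "\<bar>y0 x\<bar> \<le> \<bar>B\<bar> * norm x" if "x \<in> Y" for x
  proof -
    have "\<bar>y0 x\<bar> \<le> B * norm x" using B that by blast
    also have "\<dots> \<le> \<bar>B\<bar> * norm x" by (intro mult_right_mono) auto
    finally show ?thesis .
  qed
  have y0add: "y0 (x + z) = y0 x + y0 z" if "x \<in> Y" "z \<in> Y" for x z
    using y0 that by (simp add: dual_space_subspace)
  have y0scale: "y0 (c *\<^sub>R x) = c * y0 x" if "x \<in> Y" for c x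
    using y0 that by (simp add: dual_space_subspace)
  \<comment> \<open>An extension of the limit \<open>y0\<close>, added back at the end:
    \<open>e (r k) + u\<close> restricts on \<open>Y\<close> to
    \<open>d (r k) + y0 = y (r k)\<close>.\<close>
  obtain u where u: "linear u" "\<And>x. \<bar>u x\<bar> \<le> \<bar>B\<bar> * norm x" "\<And>x. x \<in> Y \<Longrightarrow> u x = y0 x"
    by (rule bounded_extension[OF Y(1) abs_ge_zero y0add y0scale y0bound]) blast+
  obtain r l where r: "strict_mono r" and l: "l \<in> annihilator_ball Y M"
    and el: "\<And>x. (\<lambda>k. e (r k) x) \<longlonglongrightarrow> l x"
  proof (rule bounded_null_on_subspace_convergent_subsequence[OF Y assms(3) e(1) M(1) e(2)])
    fix x assume "x \<in> Y"
    then show "(\<lambda>n. e n x) \<longlonglongrightarrow> 0" using dnull e(3) by simp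
  qed blast
  have dual: "(\<lambda>x. f x + u x) \<in> dual_space ?X"
    if f: "linear f" "\<And>x. \<bar>f x\<bar> \<le> M * norm x" for f
  proof -
    have "\<bar>f x + u x\<bar> \<le> (M + \<bar>B\<bar>) * norm x" for x
      using f(2)[of x] u(2)[of x] by (simp add: distrib_right)
    then have "(\<lambda>x. f x + u x) \<in> dual_space (?X\<lparr>vecs := UNIV\<rparr>)"
      unfolding dual_space_subspace
      using f(1) u(1) by (auto simp: linear_add linear_scale distrib_left)
    then show ?thesis by (simp only: XUNIV)
  qed
  let ?x = "\<lambda>k x. e (r k) x + u x"
  have range: "range ?x \<subseteq> dual_space ?X" using dual e by blast
  have "limitin (weak_star ?X) ?x (\<lambda>x. l x + u x) sequentially"
  proof -
    have "(\<lambda>x. l x + u x) \<in> dual_space ?X" using dual l by (simp add: annihilator_ball_def)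
    moreover have "(\<lambda>k. ?x k x) \<longlonglongrightarrow> l x + u x" for x by (intro tendsto_intros el)
    ultimately show ?thesis
      using limitin_weak_star_subspace[of ?x UNIV "\<lambda>x. l x + u x"] range unfolding XUNIV by blast
  qed
  moreover have "restrict (?x k) Y = y (r k)" for k
    using yn[of "r k"] by (intro extensionalityI[of _ Y]) (auto simp: e(3) u(3) d_def dual_space_subspace)
  ultimately show "\<exists>r x x0. strict_mono r \<and> range x \<subseteq> dual_space ?X \<and>
      limitin (weak_star ?X) x x0 sequentially \<and> (\<forall>k. restrict (x k) Y = y (r k))"
    using r range by blast
qed

end
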